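(* The Heawood graph and the Pappus graph are the only irreducible Levi graphs which are pseudo $2$-factor isomorphic. That is, for every finite simple graph $G$, the following are equivalent: (i) $G$ is an irreducible Levi graph (i.e. $G$ is isomorphic to the Levi graph of a connected irreducible symmetric configuration $n_3$ for some $n$) and $G$ is pseudo $2$-factor isomorphic; (ii) $G$ is isomorphic to the Heawood graph $H_0$ or to the Pappus graph $P_0$.
   Context: All graphs are finite and simple. A $2$-factor of a graph is a $2$-regular spanning subgraph, i.e. a spanning subgraph that is a disjoint union of circuits. A graph is pseudo $2$-factor isomorphic if the parity of the number of circuits in a $2$-factor is the same for all of its $2$-factors. An incidence structure is linear if any two different points are incident with at most one common line. A symmetric configuration $n_3$ is a linear incidence structure with $n$ points and $n$ lines such that each point is incident with exactly $3$ lines and each line with exactly $3$ points. Its Levi graph (incidence graph) is the cubic bipartite graph whose vertices are the points and the lines, a point and a line being adjacent iff they are incident. A configuration is connected if its Levi graph is connected. Martinetti extension: let $\mathcal C$ be a symmetric configuration $(n-1)_3$ with two non-intersecting lines $\{\alpha,\alpha_1,\alpha_2\}$ and $\{\beta,\beta_1,\beta_2\}$ such that the points $\alpha,\beta$ are not on a common line. Delete these two lines, add a new point $\mu$, and add the lines $\{\mu,\alpha_1,\alpha_2\}$, $\{\mu,\beta_1,\beta_2\}$, $\{\mu,\alpha,\beta\}$; the result is a symmetric configuration $n_3$. A symmetric configuration $n_3$ is irreducible if it cannot be obtained in this way from any symmetric configuration $(n-1)_3$. An irreducible Levi graph is the Levi graph of a connected irreducible symmetric configuration $n_3$. Known description of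 the irreducible Levi graphs (a theorem of Boben, completing Martinetti's list, which may be taken as given): up to isomorphism they are exactly the following graphs. (1) $D(n)$, $n\ge 7$: the Levi graph of the cyclic configuration with base line $\{0,1,3\}$, i.e. with point set $\mathbb Z_n$ and lines $\{i,i+1,i+3\}$, $i\in\mathbb Z_n$. (2) $T_1(n),T_2(n),T_3(n)$, $n\ge1$, defined as follows. The segment $G_T$ with index $i$ has the $20$ vertices $u_i^j,w_i^j,x_i^j,y_i^j,z_i^j,v_i^j$ ($j=1,2,3$), $t_i^1,t_i^2$, and (omitting the subscript $i$) the $27$ edges $u^1w^1,\ w^1x^1,\ x^1y^1,\ y^1z^1,\ z^1v^1$; $u^3w^3,\ w^3x^3,\ x^3y^3,\ y^3z^3,\ z^3v^3$; $u^1w^2,\ u^2w^1,\ u^2w^3,\ u^3w^2,\ w^2x^2,\ x^2y^2$; $y^1z^2,\ y^2z^1,\ y^2z^3,\ y^3z^2,\ z^2v^2$; $x^1t^1,\ x^2t^1,\ x^3t^1$; $v^1t^2,\ v^2t^2,\ v^3t^2$. The graph $T(n)$ consists of $n$ disjoint segments with indices $i=1,\dots,n$, together with the edges $v_{i-1}^1u_i^1,\ v_{i-1}^2u_i^2,\ v_{i-1}^3u_i^3$ for $2\le i\le n$. Then $T_1(n)$ is $T(n)$ plus the edges $u_1^1v_n^1,u_1^2v_n^2,u_1^3v_n^3$; $T_2(n)$ is $T(n)$ plus the edges $u_1^3v_n^1,u_1^2v_n^2,u_1^1v_n^3$; $T_3(n)$ is $T(n)$ plus the edges $u_1^1v_n^3,u_1^2v_n^1,u_1^3v_n^2$.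 (3) The Pappus graph $P_0$. The Heawood graph $H_0$ is the Levi graph of the Fano plane (the unique $7_3$ configuration); $H_0=D(7)$. The Pappus graph $P_0$ is the Levi graph of the Pappus $9_3$ configuration; explicitly, it has vertices $v_1,\dots,v_{18}$, the edges of the circuit $v_1v_2\cdots v_{18}v_1$, and the edges $v_1v_6,\ v_2v_9,\ v_3v_{14},\ v_4v_{11},\ v_5v_{16},\ v_7v_{12},\ v_8v_{15},\ v_{10}v_{17},\ v_{13}v_{18}$. *)

theory Defs
  imports Main
begin

section \<open>Finite simple graphs\<close>

record 'a graph =
  verts :: "'a set"
  edges :: "'a set set"

definition simple_graph :: "'a graph \<Rightarrow> bool" where
  "simple_graph G \<longleftrightarrow> finite (verts G) \<and> (\<forall>e\<in>edges G. e \<subseteq> verts G \<and> card e = 2)"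

definition graph_iso :: "'a graph \<Rightarrow> 'b graph \<Rightarrow> bool"  (infix "\<simeq>g" 50) where
  "G \<simeq>g H \<longleftrightarrow> (\<exists>f. bij_betw f (verts G) (verts H) \<and>
     (\<forall>u\<in>verts G. \<forall>v\<in>verts G. {u, v} \<in> edges G \<longleftrightarrow> {f u, f v} \<in> edges H))"

text \<open>The empty graph is not connected.\<close>

definition connected_graph :: "'a graph \<Rightarrow> bool" where
  "connected_graph G \<longleftrightarrow> verts G \<noteq> {} \<and>
     (\<forall>u\<in>verts G. \<forall>v\<in>verts G. (u, v) \<in> {(x, y). {x, y} \<in> edges G}\<^sup>*)"

definition vertex_degree :: "'a graph \<Rightarrow> 'a \<Rightarrow> nat" where
  "vertex_degree G v = card {e \<in> edges G. v \<in> e}"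

definition subgraph :: "'a graph \<Rightarrow> 'a graph \<Rightarrow> bool" where
  "subgraph H G \<longleftrightarrow> simple_graph H \<and> verts H \<subseteq> verts G \<and> edges H \<subseteq> edges G"

definition circuit :: "'a graph \<Rightarrow> bool" where
  "circuit C \<longleftrightarrow> (\<exists>vs. length vs \<ge> 3 \<and> distinct vs \<and> verts C = set vs \<and>
     edges C = (\<lambda>i. {vs ! i, vs ! (Suc i mod length vs)}) ` {..<length vs})"

definition two_factor :: "'a graph \<Rightarrow> 'a graph \<Rightarrow> bool" where
  "two_factor F G \<longleftrightarrow> subgraph F G \<and> verts F = verts G \<and> (\<forall>v\<in>verts F. vertex_degree F v = 2)"

text \<open>A 2-factor is a disjoint union of circuits, and these are all the circuits it contains.\<close>

definition num_circuits :: "'a graph \<Rightarrow> nat" where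
  "num_circuits F = card {C. circuit C \<and> subgraph C F}"

definition pseudo_two_factor_isomorphic :: "'a graph \<Rightarrow> bool" where
  "pseudo_two_factor_isomorphic G \<longleftrightarrow>
     (\<forall>F F'. two_factor F G \<and> two_factor F' G \<longrightarrow> (even (num_circuits F) \<longleftrightarrow> even (num_circuits F')))"

section \<open>Symmetric configurations and Martinetti extensions\<close>

text \<open>A line is identified with the set of its points: in a linear incidence structure with three
  points on every line, different lines have different point sets.\<close>

record 'p incidence_structure =
  points :: "'p set"
  lines :: "'p set set"

definition linear_structure :: "'p incidence_structure \<Rightarrow> bool" where
  "linear_structure C \<longleftrightarrow> (\<forall>p\<in>points C. \<forall>q\<in>points C. p \<noteq> q \<longrightarrow>
     (\<forall>L\<in>lines C. \<forall>M\<in>lines C. p \<in> L \<and> q \<in> L \<and> p \<in> M \<and> q \<in> M \<longrightarrow> L = M))"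

definition symmetric_configuration :: "nat \<Rightarrow> 'p incidence_structure \<Rightarrow> bool" where
  "symmetric_configuration n C \<longleftrightarrow>
     finite (points C) \<and> card (points C) = n \<and> card (lines C) = n \<and>
     (\<forall>L\<in>lines C. L \<subseteq> points C \<and> card L = 3) \<and>
     (\<forall>p\<in>points C. card {L \<in> lines C. p \<in> L} = 3) \<and>
     linear_structure C"

definition levi_graph :: "'p incidence_structure \<Rightarrow> ('p + 'p set) graph" where
  "levi_graph C = \<lparr> verts = Inl ` points C \<union> Inr ` lines C,
     edges = {{Inl p, Inr L} | p L. p \<in> points C \<and> L \<in> lines C \<and> p \<in> L} \<rparr>"

definition martinetti_extension :: "'p incidence_structure \<Rightarrow> 'p incidence_structure \<Rightarrow> bool" where
  "martinetti_extension C D \<longleftrightarrow> (\<exists>a a1 a2 b b1 b2 m.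
     {a, a1, a2} \<in> lines C \<and> {b, b1, b2} \<in> lines C \<and> {a, a1, a2} \<inter> {b, b1, b2} = {} \<and>
     \<not> (\<exists>L\<in>lines C. a \<in> L \<and> b \<in> L) \<and> m \<notin> points C \<and>
     D = \<lparr> points = insert m (points C),
           lines = (lines C - {{a, a1, a2}, {b, b1, b2}}) \<union> {{m, a1, a2}, {m, b1, b2}, {m, a, b}} \<rparr>)"

text \<open>The smaller configuration need not be connected. Its points are points of the larger one, so
  taking both over the same type is no restriction.\<close>

definition irreducible_configuration :: "nat \<Rightarrow> 'p incidence_structure \<Rightarrow> bool" where
  "irreducible_configuration n C \<longleftrightarrow> symmetric_configuration n C \<and>
     \<not> (\<exists>k C'. n = Suc k \<and> symmetric_configuration k C' \<and> martinetti_extension C' C)"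

text \<open>Configurations are finite, so up to isomorphism their points are natural numbers.\<close>

definition irreducible_levi_graph :: "'a graph \<Rightarrow> bool" where
  "irreducible_levi_graph G \<longleftrightarrow> (\<exists>n (C :: nat incidence_structure).
     irreducible_configuration n C \<and> connected_graph (levi_graph C) \<and> G \<simeq>g levi_graph C)"

section \<open>The graphs in the classification of irreducible Levi graphs\<close>

definition cyclic_configuration :: "nat \<Rightarrow> nat incidence_structure" where
  "cyclic_configuration n = \<lparr> points = {..<n},
     lines = (\<lambda>i. {i, (i + 1) mod n, (i + 3) mod n}) ` {..<n} \<rparr>"

definition D_graph :: "nat \<Rightarrow> (nat + nat set) graph" where
  "D_graph n = levi_graph (cyclic_configuration n)"

text \<open>\<open>Tu i j\<close> is the vertex $u_i^j$: the first argument is the index of the segment, the second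
  one the superscript; likewise for the other constructors.\<close>

datatype T_vertex = Tu nat nat | Tw nat nat | Tx nat nat | Ty nat nat | Tz nat nat | Tv nat nat | Tt nat nat

definition segment_verts :: "nat \<Rightarrow> T_vertex set" where
  "segment_verts i =
     (\<Union>j\<in>{1, 2, 3}. {Tu i j, Tw i j, Tx i j, Ty i j, Tz i j, Tv i j}) \<union> {Tt i 1, Tt i 2}"

definition segment_edges :: "nat \<Rightarrow> T_vertex set set" where
  "segment_edges i =
    {{Tu i 1, Tw i 1}, {Tw i 1, Tx i 1}, {Tx i 1, Ty i 1}, {Ty i 1, Tz i 1}, {Tz i 1, Tv i 1},
     {Tu i 3, Tw i 3}, {Tw i 3, Tx i 3}, {Tx i 3, Ty i 3}, {Ty i 3, Tz i 3}, {Tz i 3, Tv i 3},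
     {Tu i 1, Tw i 2}, {Tu i 2, Tw i 1}, {Tu i 2, Tw i 3}, {Tu i 3, Tw i 2}, {Tw i 2, Tx i 2}, {Tx i 2, Ty i 2},
     {Ty i 1, Tz i 2}, {Ty i 2, Tz i 1}, {Ty i 2, Tz i 3}, {Ty i 3, Tz i 2}, {Tz i 2, Tv i 2},
     {Tx i 1, Tt i 1}, {Tx i 2, Tt i 1}, {Tx i 3, Tt i 1},
     {Tv i 1, Tt i 2}, {Tv i 2, Tt i 2}, {Tv i 3, Tt i 2}}"

definition T_graph :: "nat \<Rightarrow> T_vertex graph" where
  "T_graph n = \<lparr> verts = (\<Union>i\<in>{1..n}. segment_verts i),
     edges = (\<Union>i\<in>{1..n}. segment_edges i) \<union>
             (\<Union>i\<in>{2..n}. {{Tv (i - 1) 1, Tu i 1}, {Tv (i - 1) 2, Tu i 2}, {Tv (i - 1) 3, Tu i 3}}) \<rparr>"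

definition T1_graph :: "nat \<Rightarrow> T_vertex graph" where
  "T1_graph n = \<lparr> verts = verts (T_graph n),
     edges = edges (T_graph n) \<union> {{Tu 1 1, Tv n 1}, {Tu 1 2, Tv n 2}, {Tu 1 3, Tv n 3}} \<rparr>"

definition T2_graph :: "nat \<Rightarrow> T_vertex graph" where
  "T2_graph n = \<lparr> verts = verts (T_graph n),
     edges = edges (T_graph n) \<union> {{Tu 1 3, Tv n 1}, {Tu 1 2, Tv n 2}, {Tu 1 1, Tv n 3}} \<rparr>"

definition T3_graph :: "nat \<Rightarrow> T_vertex graph" where
  "T3_graph n = \<lparr> verts = verts (T_graph n),
     edges = edges (T_graph n) \<union> {{Tu 1 1, Tv n 3}, {Tu 1 2, Tv n 1}, {Tu 1 3, Tv n 2}} \<rparr>"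

definition fano_plane :: "nat incidence_structure" where
  "fano_plane = \<lparr> points = {0, 1, 2, 3, 4, 5, 6},
     lines = {{0, 1, 3}, {1, 2, 4}, {2, 3, 5}, {3, 4, 6}, {4, 5, 0}, {5, 6, 1}, {6, 0, 2}} \<rparr>"

definition heawood_graph :: "(nat + nat set) graph" where
  "heawood_graph = levi_graph fano_plane"

definition pappus_graph :: "nat graph" where
  "pappus_graph = \<lparr> verts = {1..18},
     edges = insert {18, 1} {{i, i + 1} | i. i \<in> {1..17}} \<union>
             {{1, 6}, {2, 9}, {3, 14}, {4, 11}, {5, 16}, {7, 12}, {8, 15}, {10, 17}, {13, 18}} \<rparr>"

end

(* In a bipartite graph a 2-factor is a union of two disjoint perfect matchings p, q between the colour
   classes, and its circuits are the cycles of the permutation p^{-1} q. Hence the parity of their number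
   is given by the sign of p^{-1} q, and it changes as soon as p and q are composed with permutations of
   opposite signs. In D(n), n >= 8, and in T_1(n), T_2(n), T_3(n) such a change can be made locally, in a
   window of bounded size, for all n at once. For D(7), the Heawood graph, and for the Pappus graph the
   2-factors are the complements of the 24, respectively 42, perfect matchings; all of them have an odd
   number of circuits. *)

theory Submission
  imports Defs "HOL-Combinatorics.Cycles"
begin

section \<open>Isomorphism invariance\<close>

text \<open>A local switch is usable because the sign belonging to one concrete 2-factor, which
  depends on the whole graph, cancels when two 2-factors are compared; only the signs of a few short
  cycles remain. For D(n) the obstacle is that a perfect matching has to close up around Z_n for
  every n. It is therefore assembled from blocks that fit together in any order: in a block of L
  lines starting at line b, one matching uses the points b+1, ..., b+L and the other b+1, b+3, ...,
  b+L, b+L+2, so that every block leaves to the next one exactly the gap that it found itself. Such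
  blocks exist in lengths 3, 4 and 5, and n is split in two ways whose numbers of 5s differ in
  parity. The only splitting of 7 is 3 + 4, in accordance with the Heawood graph being an exception;
  10 = 3 + 3 + 4 = 5 + 5 gives an even number of 5s in both cases, which is why D(10) is treated
  apart.\<close>

definition map_graph :: "('a \<Rightarrow> 'b) \<Rightarrow> 'a graph \<Rightarrow> 'b graph" where
  "map_graph f G = \<lparr>verts = f ` verts G, edges = (`) f ` edges G\<rparr>"

lemma map_graph_sel [simp]:
  "verts (map_graph f G) = f ` verts G" "edges (map_graph f G) = (`) f ` edges G"
  by (simp_all add: map_graph_def)

lemma graph_eqI: "verts G = verts H \<Longrightarrow> edges G = edges H \<Longrightarrow> G = (H :: 'a graph)"
  by (cases G; cases H) simp

lemma simple_graph_edge_subset: "simple_graph G \<Longrightarrow> e \<in> edges G \<Longrightarrow> e \<subseteq> verts G"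
  by (auto simp: simple_graph_def)

lemma simple_graph_finite_edges: "simple_graph G \<Longrightarrow> finite (edges G)"
  unfolding simple_graph_def by (metis PowI finite_Pow_iff finite_subset subsetI)

lemma circuit_edge_subset: "circuit C \<Longrightarrow> e \<in> edges C \<Longrightarrow> e \<subseteq> verts C"
  unfolding circuit_def by (auto intro!: nth_mem mod_less_divisor)

lemma graph_iso_sym:
  assumes "G \<simeq>g H" shows "H \<simeq>g G"
proof -
  obtain f where f: "bij_betw f (verts G) (verts H)"
    "\<And>u v. u \<in> verts G \<Longrightarrow> v \<in> verts G \<Longrightarrow> {u, v} \<in> edges G \<longleftrightarrow> {f u, f v} \<in> edges H"
    using assms unfolding graph_iso_def by blast
  let ?g = "inv_into (verts G) f"
  have "{u, v} \<in> edges H \<longleftrightarrow> {?g u, ?g v} \<in> edges G" if "u \<in> verts H" "v \<in> verts H" for u v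
    using f(2)[of "?g u" "?g v"] that f(1)
    by (simp add: bij_betw_def f_inv_into_f inv_into_into)
  then show ?thesis
    unfolding graph_iso_def using bij_betw_inv_into[OF f(1)] by blast
qed

lemma map_graph_inv:
  assumes "inj_on f V" "verts G \<subseteq> V" "\<And>e. e \<in> edges G \<Longrightarrow> e \<subseteq> V"
  shows "map_graph (inv_into V f) (map_graph f G) = G"
proof (rule graph_eqI)
  have "inv_into V f ` f ` e = e" if "e \<in> edges G" for e
    using assms(1) assms(3)[OF that] by (rule inv_into_image_cancel)
  then show "edges (map_graph (inv_into V f) (map_graph f G)) = edges G"
    by (simp add: image_image)
qed (use assms in simp)

lemma simple_map_graph:
  assumes "simple_graph G" "inj_on f (verts G)"
  shows "simple_graph (map_graph f G)"
  using assms unfolding simple_graph_def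
  by (auto simp: card_image[OF inj_on_subset[OF assms(2)]])

lemma circuit_map_graph:
  assumes "circuit C" "inj_on f (verts C)"
  shows "circuit (map_graph f C)"
proof -
  obtain vs where vs: "length vs \<ge> 3" "distinct vs" "verts C = set vs"
     "edges C = (\<lambda>i. {vs ! i, vs ! (Suc i mod length vs)}) ` {..<length vs}"
    using assms(1) unfolding circuit_def by blast
  have lt: "Suc i mod length vs < length vs" for i
    using vs(1) by (intro mod_less_divisor) auto
  have "edges (map_graph f C) = (\<lambda>i. f ` {vs ! i, vs ! (Suc i mod length vs)}) ` {..<length vs}"
    by (simp add: vs(4) image_image)
  also have "\<dots> = (\<lambda>i. {map f vs ! i, map f vs ! (Suc i mod length vs)}) ` {..<length vs}"
    using lt by (intro image_cong) auto
  finally show ?thesis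
    unfolding circuit_def using vs assms(2)
    by (intro exI[of _ "map f vs"]) (simp add: distinct_map)
qed

lemma subgraph_map_graph:
  assumes "subgraph C F" "inj_on f (verts F)"
  shows "subgraph (map_graph f C) (map_graph f F)"
  using assms unfolding subgraph_def
  by (auto intro!: simple_map_graph intro: inj_on_subset)

lemma num_circuits_map_graph:
  assumes F: "simple_graph F" and inj: "inj_on f (verts F)"
  shows "num_circuits (map_graph f F) = num_circuits F"
proof -
  let ?g = "inv_into (verts F) f"
  have "bij_betw (map_graph f) {C. circuit C \<and> subgraph C F}
          {C. circuit C \<and> subgraph C (map_graph f F)}"
  proof (rule bij_betw_byWitness[where f' = "map_graph ?g"])
    have sub: "verts C \<subseteq> verts F" "\<And>e. e \<in> edges C \<Longrightarrow> e \<subseteq> verts F" if "subgraph C F" for C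
      using that simple_graph_edge_subset[OF F] by (auto simp: subgraph_def)
    have sub': "verts C \<subseteq> f ` verts F" "\<And>e. e \<in> edges C \<Longrightarrow> e \<subseteq> f ` verts F"
      if "subgraph C (map_graph f F)" for C
      using that simple_graph_edge_subset[OF F] by (fastforce simp: subgraph_def)+
    have gf: "map_graph ?g (map_graph f F) = F"
      by (rule map_graph_inv[OF inj]) (use simple_graph_edge_subset[OF F] in auto)
    have injg: "inj_on ?g (f ` verts F)"
      by (rule inj_on_inv_into) simp
    show "\<forall>C\<in>{C. circuit C \<and> subgraph C F}. map_graph ?g (map_graph f C) = C"
      using sub inj by (blast intro: map_graph_inv)
    show "map_graph f ` {C. circuit C \<and> subgraph C F} \<subseteq> {C. circuit C \<and> subgraph C (map_graph f F)}"
      using sub inj by (auto intro!: circuit_map_graph subgraph_map_graph intro: inj_on_subset)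
    show "map_graph ?g ` {C. circuit C \<and> subgraph C (map_graph f F)} \<subseteq> {C. circuit C \<and> subgraph C F}"
    proof safe
      fix C assume C: "circuit C" "subgraph C (map_graph f F)"
      show "circuit (map_graph ?g C)"
        using C sub'(1) injg by (blast intro: circuit_map_graph inj_on_subset)
      show "subgraph (map_graph ?g C) F"
        using subgraph_map_graph[OF C(2), of ?g] injg gf by simp
    qed
    have "f ` ?g ` X = X" if "X \<subseteq> f ` verts F" for X
      using that by (simp add: image_inv_into_cancel)
    then show "\<forall>C\<in>{C. circuit C \<and> subgraph C (map_graph f F)}. map_graph f (map_graph ?g C) = C"
      using sub' by (auto intro!: graph_eqI simp: image_image) 
  qed
  then show ?thesis
    unfolding num_circuits_def by (simp add: bij_betw_same_card)
qed

lemma two_factor_map_graph: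
  assumes FG: "two_factor F G" and bij: "bij_betw f (verts G) (verts H)"
    and edge: "\<And>u v. u \<in> verts G \<Longrightarrow> v \<in> verts G \<Longrightarrow> {u, v} \<in> edges G \<longleftrightarrow> {f u, f v} \<in> edges H"
  shows "two_factor (map_graph f F) H"
proof -
  have F: "simple_graph F" "verts F = verts G" "edges F \<subseteq> edges G"
    and deg: "\<And>v. v \<in> verts F \<Longrightarrow> vertex_degree F v = 2"
    using FG by (auto simp: two_factor_def subgraph_def)
  have inj: "inj_on f (verts F)" and im: "f ` verts F = verts H"
    using bij F(2) by (auto simp: bij_betw_def)
  have "f ` e \<in> edges H" if "e \<in> edges F" for e
  proof -
    have "e \<subseteq> verts G" "card e = 2"
      using that F(1,2) by (auto simp: simple_graph_def)
    then obtain u v where "e = {u, v}" "u \<in> verts G" "v \<in> verts G"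
      by (auto simp: card_2_iff)
    then show ?thesis using that F(3) edge by auto
  qed
  moreover have "vertex_degree (map_graph f F) (f v) = 2" if v: "v \<in> verts F" for v
  proof -
    have "f v \<in> f ` e \<longleftrightarrow> v \<in> e" if "e \<in> edges F" for e
      using inj_on_image_mem_iff[OF inj v simple_graph_edge_subset[OF F(1) that]] .
    then have "{e \<in> edges (map_graph f F). f v \<in> e} = (`) f ` {e \<in> edges F. v \<in> e}"
      by auto
    moreover have "inj_on ((`) f) {e \<in> edges F. v \<in> e}"
      by (rule inj_on_subset[OF inj_on_image_Pow[OF inj]])
         (use simple_graph_edge_subset[OF F(1)] in blast)
    ultimately show ?thesis
      using deg[OF v] unfolding vertex_degree_def by (metis card_image)
  qed
  ultimately show ?thesis
    unfolding two_factor_def subgraph_def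
    by (simp add: simple_map_graph[OF F(1) inj] im image_subset_iff flip: im)
qed

lemma pseudo_two_factor_isomorphic_iso:
  assumes iso: "G \<simeq>g H" and H: "pseudo_two_factor_isomorphic H"
  shows "pseudo_two_factor_isomorphic G"
proof -
  obtain f where bij: "bij_betw f (verts G) (verts H)"
    and edge: "\<And>u v. u \<in> verts G \<Longrightarrow> v \<in> verts G \<Longrightarrow> {u, v} \<in> edges G \<longleftrightarrow> {f u, f v} \<in> edges H"
    using iso unfolding graph_iso_def by blast
  have "num_circuits (map_graph f F) = num_circuits F" if "two_factor F G" for F
    using that bij by (intro num_circuits_map_graph) (auto simp: two_factor_def subgraph_def bij_betw_def)
  then show ?thesis
    using H two_factor_map_graph[OF _ bij edge]
    unfolding pseudo_two_factor_isomorphic_def by metis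
qed

section \<open>Circuits of a 2-factor\<close>

text \<open>The lower bound is what matters: inside a graph of degree 2 it forces a circuit to
  contain every edge at each of its vertices.\<close>

lemma circuit_vertex_degree:
  assumes C: "circuit C" and v: "v \<in> verts C"
  shows "card {e \<in> edges C. v \<in> e} \<ge> 2"
proof -
  obtain vs where vs: "length vs \<ge> 3" "distinct vs" "verts C = set vs"
     "edges C = (\<lambda>i. {vs ! i, vs ! (Suc i mod length vs)}) ` {..<length vs}"
    using C unfolding circuit_def by blast
  define l where "l = length vs"
  obtain i where i: "i < l" "v = vs ! i"
    using v vs(3) by (auto simp: in_set_conv_nth l_def)
  \<comment> \<open>\<open>j\<close> and \<open>k\<close> are the cyclic predecessor and successor
    of \<open>i\<close>; they differ because the circuit has at least three vertices.\<close>
  define j where "j = (if i = 0 then l - 1 else i - 1)"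
  define k where "k = (if Suc i = l then 0 else Suc i)"
  have l: "l \<ge> 3" using vs(1) by (simp add: l_def)
  have j: "j < l" "Suc j mod l = i" using i l by (auto simp: j_def)
  have k: "k < l" "Suc i mod l = k" using i l by (auto simp: k_def)
  have d: "i \<noteq> j" "i \<noteq> k" "j \<noteq> k" using i l by (auto simp: j_def k_def)
  have "{vs ! i, vs ! k} \<in> edges C" "{vs ! j, vs ! i} \<in> edges C"
    using i j k unfolding vs(4) l_def by force+
  moreover have "{vs ! i, vs ! k} \<noteq> {vs ! j, vs ! i}"
    using d i j k vs(2) by (auto simp: doubleton_eq_iff nth_eq_iff_index_eq l_def)
  ultimately have "card {{vs ! i, vs ! k}, {vs ! j, vs ! i}} = 2"
    "{{vs ! i, vs ! k}, {vs ! j, vs ! i}} \<subseteq> {e \<in> edges C. v \<in> e}"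
    using i by auto
  moreover have "finite {e \<in> edges C. v \<in> e}"
    using vs(4) by simp
  ultimately show ?thesis by (metis card_mono)
qed

text \<open>Connectedness of a circuit: membership in \<open>S\<close> is handed on along the edges,
  once around from \<open>u\<close>.\<close>

lemma circuit_vertices_subset:
  assumes C: "circuit C" and u: "u \<in> verts C" "u \<in> S"
    and closed: "\<And>e. e \<in> edges C \<Longrightarrow> e \<inter> S \<noteq> {} \<Longrightarrow> e \<subseteq> S"
  shows "verts C \<subseteq> S"
proof -
  obtain vs where vs: "length vs \<ge> 3" "distinct vs" "verts C = set vs"
     "edges C = (\<lambda>i. {vs ! i, vs ! (Suc i mod length vs)}) ` {..<length vs}"
    using C unfolding circuit_def by blast
  let ?l = "length vs"
  obtain i where i: "i < ?l" "u = vs ! i"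
    using u vs(3) by (auto simp: in_set_conv_nth)
  have "vs ! ((i + k) mod ?l) \<in> S" for k
  proof (induction k)
    case (Suc k)
    let ?j = "(i + k) mod ?l"
    have "?j < ?l" using vs(1) by (intro mod_less_divisor) auto
    then have "{vs ! ?j, vs ! (Suc ?j mod ?l)} \<in> edges C"
      unfolding vs(4) by blast
    from closed[OF this] Suc.IH show ?case by (simp add: mod_Suc_eq)
  qed (use i u in simp)
  \<comment> \<open>Going \<open>?l - i + j\<close> steps from \<open>i\<close> ends at
    \<open>?l + j\<close>, that is at \<open>j\<close>; the full turn avoids a truncated difference
    \<open>j - i\<close>.\<close>
  moreover have "\<exists>k. vs ! j = vs ! ((i + k) mod ?l)" if "j < ?l" for j
    using that i by (intro exI[of _ "?l - i + j"]) simp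
  ultimately show ?thesis
    unfolding vs(3) by (metis in_set_conv_nth subsetI)
qed

lemma circuit_edge_nonempty:
  assumes "circuit C" "e \<in> edges C" shows "e \<noteq> {}"
  using assms unfolding circuit_def by auto

text \<open>By the degree count a circuit of \<open>F\<close> has the same edges at its vertices as
  \<open>F\<close> itself, so no edge of \<open>F\<close> leaves its vertex set. Hence the circuits
  in \<open>F\<close> are its components.\<close>

lemma intersecting_circuits_eq:
  assumes F: "simple_graph F" and deg: "\<And>v. v \<in> verts F \<Longrightarrow> vertex_degree F v = 2"
    and C: "circuit C" "subgraph C F" and D: "circuit D" "subgraph D F"
    and u: "u \<in> verts C" "u \<in> verts D"
  shows "C = D"
proof -
  have star: "{e \<in> edges C. v \<in> e} = {e \<in> edges F. v \<in> e}"
    if "circuit C" "subgraph C F" "v \<in> verts C" for C v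
  proof (rule card_subset_eq)
    show "finite {e \<in> edges F. v \<in> e}"
      using simple_graph_finite_edges[OF F] by simp
    show sub: "{e \<in> edges C. v \<in> e} \<subseteq> {e \<in> edges F. v \<in> e}"
      using that by (auto simp: subgraph_def)
    have "card {e \<in> edges F. v \<in> e} = 2"
      using deg[of v] that by (auto simp: vertex_degree_def subgraph_def)
    moreover have "card {e \<in> edges C. v \<in> e} \<le> card {e \<in> edges F. v \<in> e}"
      using sub \<open>finite _\<close> by (rule card_mono[rotated])
    ultimately show "card {e \<in> edges C. v \<in> e} = card {e \<in> edges F. v \<in> e}"
      using circuit_vertex_degree[OF that(1,3)] by simp
  qed
  have *: "verts D \<subseteq> verts C"
    if C: "circuit C" "subgraph C F" and D: "circuit D" "subgraph D F"
      and u: "u \<in> verts C" "u \<in> verts D" for C D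
  proof (rule circuit_vertices_subset[OF D(1) u(2,1)])
    fix e assume e: "e \<in> edges D" "e \<inter> verts C \<noteq> {}"
    then obtain v where v: "v \<in> e" "v \<in> verts C" by blast
    have "e \<in> edges F" using e D by (auto simp: subgraph_def)
    then have "e \<in> edges C" using star[OF C v(2)] v by blast
    then show "e \<subseteq> verts C" by (rule circuit_edge_subset[OF C(1)])
  qed
  have V: "verts C = verts D"
    using *[OF C D u] *[OF D C u(2,1)] by simp
  have "edges C \<subseteq> edges D"
    if C: "circuit C" "subgraph C F" and D: "circuit D" "subgraph D F" and V: "verts C = verts D" for C D
  proof
    fix e assume e: "e \<in> edges C"
    then obtain v where "v \<in> e" using circuit_edge_nonempty[OF C(1)] by blast
    then show "e \<in> edges D"
      using e star[OF C] star[OF D] circuit_edge_subset[OF C(1) e] V by blast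
  qed
  then have "edges C = edges D" using C D V by blast
  with V show ?thesis by (rule graph_eqI)
qed

section \<open>Counting circuits from an explicit list of vertex cycles\<close>

definition circuit_of :: "'a list \<Rightarrow> 'a graph" where
  "circuit_of vs = \<lparr>verts = set vs,
     edges = (\<lambda>i. {vs ! i, vs ! (Suc i mod length vs)}) ` {..<length vs}\<rparr>"

lemma circuit_circuit_of: "length vs \<ge> 3 \<Longrightarrow> distinct vs \<Longrightarrow> circuit (circuit_of vs)"
  by (auto simp: circuit_def circuit_of_def)

lemma simple_circuit_of:
  assumes "length vs \<ge> 3" "distinct vs"
  shows "simple_graph (circuit_of vs)"
proof -
  have "i \<noteq> Suc i mod length vs" "Suc i mod length vs < length vs" if "i < length vs" for i
    using that assms(1) by (auto simp: mod_Suc)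
  then show ?thesis
    using assms by (auto simp: simple_graph_def circuit_of_def card_insert_if nth_eq_iff_index_eq)
qed

text \<open>The listed cycles cover all vertices, so any circuit of \<open>F\<close> meets one of
  them and therefore equals it; disjointness prevents double counting.\<close>

lemma num_circuits_eq_length:
  assumes F: "simple_graph F" and deg: "\<And>v. v \<in> verts F \<Longrightarrow> vertex_degree F v = 2"
    and dist: "distinct (concat vss)" and set: "set (concat vss) = verts F"
    and long: "\<And>vs. vs \<in> set vss \<Longrightarrow> length vs \<ge> 3"
    and edges: "\<And>vs. vs \<in> set vss \<Longrightarrow> edges (circuit_of vs) \<subseteq> edges F"
  shows "num_circuits F = length vss"
proof -
  have dvs: "distinct vs" if "vs \<in> set vss" for vs
    using dist that by (simp add: distinct_concat_iff)
  have circ: "circuit (circuit_of vs)" "subgraph (circuit_of vs) F" if "vs \<in> set vss" for vs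
  proof -
    show "circuit (circuit_of vs)"
      using long dvs that by (simp add: circuit_circuit_of)
    show "subgraph (circuit_of vs) F"
      using simple_circuit_of[OF long dvs] that edges set
      by (auto simp: subgraph_def) (auto simp: circuit_of_def)
  qed
  have "{C. circuit C \<and> subgraph C F} = circuit_of ` set vss"
  proof (intro equalityI subsetI)
    fix C assume "C \<in> {C. circuit C \<and> subgraph C F}"
    then have C: "circuit C" "subgraph C F" by auto
    then obtain u where u: "u \<in> verts C" by (fastforce simp: circuit_def)
    then have "u \<in> set (concat vss)" using C set by (auto simp: subgraph_def)
    then obtain vs where vs: "vs \<in> set vss" "u \<in> set vs" by auto
    then have "C = circuit_of vs"
      using circ intersecting_circuits_eq[OF F deg C] u by (force simp: circuit_of_def)
    then show "C \<in> circuit_of ` set vss" using vs by auto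
  qed (use circ in auto)
  moreover have "inj_on circuit_of (set vss)"
  proof (rule inj_onI)
    fix vs ws assume vs: "vs \<in> set vss" "ws \<in> set vss" "circuit_of vs = circuit_of ws"
    then have "set vs = set ws" by (simp add: circuit_of_def)
    moreover have "vs \<noteq> []" using long vs by force
    ultimately have "set vs \<inter> set ws \<noteq> {}" by auto
    then show "vs = ws"
      using dist vs(1,2) unfolding distinct_concat_iff by blast
  qed
  moreover have "distinct vss"
  proof -
    have "[] \<notin> set vss" using long by force
    then have "removeAll [] vss = vss" by simp
    then show ?thesis using dist by (simp add: distinct_concat_iff)
  qed
  ultimately show ?thesis
    by (simp add: num_circuits_def card_image distinct_card)
qed

section \<open>Parity of the number of circuits\<close>

text \<open>A cycle of length k is a product of k - 1 transpositions.\<close>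

lemma evenperm_cycle_of_list:
  "distinct cs \<Longrightarrow> cs \<noteq> [] \<Longrightarrow> evenperm (cycle_of_list cs) \<longleftrightarrow> odd (length cs)"
proof (induction cs rule: cycle_of_list.induct)
  case (1 i j cs)
  then show ?case
    by (simp del: comp_apply add: evenperm_comp permutation_swap_id permutation_of_cycle evenperm_swap)
qed auto

lemma cycle_of_list_nth:
  assumes "distinct cs" "i < length cs"
  shows "cycle_of_list cs (cs ! i) = cs ! (Suc i mod length cs)"
  using arg_cong[OF cyclic_rotation[OF assms(1), of 1], of "\<lambda>xs. xs ! i"] assms(2)
  by (simp add: nth_rotate1)

text \<open>Fixed points stay in the list as one-element cycles, so \<open>length css\<close> counts
  all cycles and the sign is (-1) to the power \<open>card A - length css\<close>. The last two
  conjuncts serve the induction: composing signs needs \<open>permutation p\<close>, and a new cycle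
  must consist of points fixed by \<open>p\<close>.\<close>

lemma cycle_decomp_list:
  assumes "cycle_decomp A p"
  shows "\<exists>css. distinct (concat css) \<and> set (concat css) = A \<and> [] \<notin> set css \<and>
           (\<forall>cs\<in>set css. \<forall>i<length cs. p (cs ! i) = cs ! (Suc i mod length cs)) \<and>
           (evenperm p \<longleftrightarrow> even (card A + length css)) \<and> permutation p \<and> (\<forall>x. x \<notin> A \<longrightarrow> p x = x)"
  using assms
proof induction
  case empty
  show ?case by (intro exI[of _ "[]"]) (simp add: permutation_id)
next
  case (comp I p cs)
  then obtain css where css: "distinct (concat css)" "set (concat css) = I" "[] \<notin> set css"
    "\<And>cs i. cs \<in> set css \<Longrightarrow> i < length cs \<Longrightarrow> p (cs ! i) = cs ! (Suc i mod length cs)"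
    "evenperm p \<longleftrightarrow> even (card I + length css)" "permutation p" "\<And>x. x \<notin> I \<Longrightarrow> p x = x"
    by blast
  show ?case
  \<comment> \<open>The inductive decomposition admits an empty cycle, which acts as the identity
    and must not enter the count.\<close>
  proof (cases "cs = []")
    case True
    then show ?thesis using css by (intro exI[of _ css]) auto
  next
    case False
    have lt: "Suc i mod length ds < length ds" if "i < length ds" for i and ds :: "'a list"
      using that by (intro mod_less_divisor) auto
    have old: "cycle_of_list cs (p (ds ! i)) = ds ! (Suc i mod length ds)"
      if "ds \<in> set css" "i < length ds" for ds i
    proof -
      have "ds ! (Suc i mod length ds) \<in> I"
        using that lt[OF that(2)] css(2) by auto
      then have "ds ! (Suc i mod length ds) \<notin> set cs"
        using comp.hyps by blast
      then show ?thesis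
        using css(4)[OF that] by (simp add: id_outside_supp)
    qed
    have new: "cycle_of_list cs (p (cs ! i)) = cs ! (Suc i mod length cs)" if "i < length cs" for i
    proof -
      have "cs ! i \<notin> I" using nth_mem[OF that] comp.hyps(3) by blast
      then show ?thesis using that comp.hyps css(7) by (simp add: cycle_of_list_nth)
    qed
    have "finite I" using css(2) by auto
    then have "card (set cs \<union> I) = length cs + card I"
      using comp.hyps by (simp add: card_Un_disjoint distinct_card)
    moreover have "permutation (cycle_of_list cs \<circ> p)"
      using css(6) permutation_of_cycle by (rule permutation_compose[rotated])
    moreover have "evenperm (cycle_of_list cs \<circ> p) \<longleftrightarrow> (odd (length cs) \<longleftrightarrow> evenperm p)"
      using evenperm_comp[OF permutation_of_cycle css(6)] evenperm_cycle_of_list[OF comp.hyps(2) False]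
      by blast
    moreover have "cycle_of_list cs (p x) = x" if "x \<notin> set cs \<union> I" for x
      using that css(7) by (simp add: id_outside_supp)
    moreover have "distinct (concat (cs # css))" "set (concat (cs # css)) = set cs \<union> I" "[] \<notin> set (cs # css)"
      using css(1-3) comp.hyps(2,3) False by auto
    moreover have "even (length cs + card I + length (cs # css)) \<longleftrightarrow> (odd (length cs) \<longleftrightarrow> evenperm p)"
      unfolding css(5) by (cases "even (card I)") auto
    moreover have "\<forall>ds\<in>set (cs # css). \<forall>i<length ds.
        (cycle_of_list cs \<circ> p) (ds ! i) = ds ! (Suc i mod length ds)"
      using old new by simp
    ultimately show ?thesis
      by (intro exI[of _ "cs # css"] conjI allI impI) (simp_all only: comp_apply o_def simp_thms)
  qed
qed

section \<open>2-regular bipartite graphs formed by two perfect matchings\<close>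

definition alternating_graph :: "'a set \<Rightarrow> ('a \<Rightarrow> 'a) \<Rightarrow> ('a \<Rightarrow> 'a) \<Rightarrow> 'a graph" where
  "alternating_graph A p q =
     \<lparr>verts = A \<union> p ` A, edges = (\<lambda>a. {a, p a}) ` A \<union> (\<lambda>a. {a, q a}) ` A\<rparr>"

locale alternating =
  fixes A B :: "'a set" and p q :: "'a \<Rightarrow> 'a"
  assumes fin: "finite A" and disj: "A \<inter> B = {}"
    and p: "bij_betw p A B" and q: "bij_betw q A B"
    and neq: "\<And>a. a \<in> A \<Longrightarrow> p a \<noteq> q a"
begin

lemma verts_alt: "verts (alternating_graph A p q) = A \<union> B"
  using p by (simp add: alternating_graph_def bij_betw_def)

lemma in_B: "a \<in> A \<Longrightarrow> p a \<in> B" "a \<in> A \<Longrightarrow> q a \<in> B"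
  using p q by (auto simp: bij_betw_def)

lemma simple_alt: "simple_graph (alternating_graph A p q)"
proof -
  have "finite B" using fin p bij_betw_finite by blast
  moreover have "a \<noteq> p a" "a \<noteq> q a" if "a \<in> A" for a
    using in_B[OF that] that disj by (metis IntI empty_iff)+
  ultimately show ?thesis
    unfolding simple_graph_def verts_alt using fin in_B
    by (auto simp: alternating_graph_def)
qed

lemma degree_alt:
  assumes v: "v \<in> verts (alternating_graph A p q)"
  shows "vertex_degree (alternating_graph A p q) v = 2"
proof (cases "v \<in> A")
  case True
  then have "{e \<in> edges (alternating_graph A p q). v \<in> e} = {{v, p v}, {v, q v}}"
    using in_B disj by (auto 0 3 simp: alternating_graph_def)
  moreover have "{v, p v} \<noteq> {v, q v}"
    using neq[OF True] by (auto simp: doubleton_eq_iff)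
  ultimately show ?thesis by (simp add: vertex_degree_def)
next
  case False
  then have "v \<in> B" using v verts_alt by auto
  then obtain a b where ab: "a \<in> A" "v = p a" "b \<in> A" "v = q b"
    using p q unfolding bij_betw_def by blast
  have "{e \<in> edges (alternating_graph A p q). v \<in> e} = {{a, v}, {b, v}}"
  proof -
    have "c = a" if "c \<in> A" "p c = v" for c
      using that ab p by (metis bij_betw_imp_inj_on inj_onD)
    moreover have "c = b" if "c \<in> A" "q c = v" for c
      using that ab q by (metis bij_betw_imp_inj_on inj_onD)
    ultimately have *: "e \<in> {{a, v}, {b, v}}" if "e \<in> edges (alternating_graph A p q)" "v \<in> e" for e
      using that False by (auto simp: alternating_graph_def)
    show ?thesis
    proof (intro equalityI subsetI)
      fix e assume "e \<in> {{a, v}, {b, v}}"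
      then consider "e = {a, p a}" | "e = {b, q b}" using ab by auto
      then show "e \<in> {e \<in> edges (alternating_graph A p q). v \<in> e}"
        using ab by cases (auto simp: alternating_graph_def)
    qed (use * in auto)
  qed
  moreover have "a \<noteq> b" using ab neq[OF ab(1)] by auto
  then have "{a, v} \<noteq> {b, v}" by (auto simp: doubleton_eq_iff)
  ultimately show ?thesis by (simp add: vertex_degree_def)
qed

lemma two_factor_alt:
  assumes "verts G = A \<union> B" "\<And>a. a \<in> A \<Longrightarrow> {a, p a} \<in> edges G" "\<And>a. a \<in> A \<Longrightarrow> {a, q a} \<in> edges G"
  shows "two_factor (alternating_graph A p q) G"
  unfolding two_factor_def subgraph_def
  using assms verts_alt simple_alt degree_alt by (auto simp: alternating_graph_def)

end

text \<open>Turns a cycle of the permutation on \<open>A\<close> into the circuit through both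
  colour classes: from \<open>a\<close> along the \<open>q\<close>-edge to \<open>q a\<close>, then
  along a \<open>p\<close>-edge to the next element of the cycle.\<close>

definition weave :: "('a \<Rightarrow> 'a) \<Rightarrow> 'a list \<Rightarrow> 'a list" where
  "weave q cs = concat (map (\<lambda>a. [a, q a]) cs)"

lemma length_weave [simp]: "length (weave q cs) = 2 * length cs"
  by (induction cs) (auto simp: weave_def)

lemma set_weave [simp]: "set (weave q cs) = set cs \<union> q ` set cs"
  by (induction cs) (auto simp: weave_def)

lemma weave_nth:
  "i < length cs \<Longrightarrow> weave q cs ! (2 * i) = cs ! i"
  "i < length cs \<Longrightarrow> weave q cs ! Suc (2 * i) = q (cs ! i)"
  by (induction cs arbitrary: i) (auto simp: weave_def nth_Cons split: nat.split)

lemma concat_map_weave: "concat (map (weave q) css) = weave q (concat css)"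
  by (induction css) (auto simp: weave_def)

lemma distinct_weave:
  "distinct cs \<Longrightarrow> inj_on q (set cs) \<Longrightarrow> q ` set cs \<inter> set cs = {} \<Longrightarrow> distinct (weave q cs)"
proof (induction cs)
  case (Cons c cs)
  then have "distinct (weave q cs)" by auto
  moreover have "weave q (c # cs) = c # q c # weave q cs" by (simp add: weave_def)
  ultimately show ?case using Cons.prems by auto
qed (simp add: weave_def)

text \<open>The hypothesis says that \<open>\<sigma>\<close> is the permutation "first
  \<open>q\<close>, then \<open>p\<close> backwards". Its cycles, woven with \<open>q\<close>, are
  precisely the circuits, so the sign formula for \<open>\<sigma>\<close> becomes a formula for
  their number.\<close>

lemma (in alternating) even_num_circuits:
  assumes \<sigma>: "\<sigma> permutes A" and pq: "\<And>a. a \<in> A \<Longrightarrow> p (\<sigma> a) = q a"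
  shows "even (num_circuits (alternating_graph A p q)) \<longleftrightarrow> (evenperm \<sigma> \<longleftrightarrow> even (card A))"
proof -
  obtain css where dist: "distinct (concat css)" and set: "set (concat css) = A" and ne: "[] \<notin> set css"
    and step: "\<And>cs i. cs \<in> set css \<Longrightarrow> i < length cs \<Longrightarrow> \<sigma> (cs ! i) = cs ! (Suc i mod length cs)"
    and parity: "evenperm \<sigma> \<longleftrightarrow> even (card A + length css)"
    using cycle_decomp_list[OF cycle_decomposition[OF \<sigma> fin]] by blast
  let ?vss = "map (weave q) css"
  have sub: "set cs \<subseteq> A" if "cs \<in> set css" for cs
    using that set by auto
  have "num_circuits (alternating_graph A p q) = length ?vss"
  proof (rule num_circuits_eq_length)
    show "distinct (concat ?vss)"
      unfolding concat_map_weave using dist set q disj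
      by (intro distinct_weave) (auto simp: bij_betw_def)
    show "set (concat ?vss) = verts (alternating_graph A p q)"
      unfolding concat_map_weave using set q by (simp add: verts_alt bij_betw_def)
    show "simple_graph (alternating_graph A p q)" by (fact simple_alt)
    show "vertex_degree (alternating_graph A p q) v = 2" if "v \<in> verts (alternating_graph A p q)" for v
      using that by (fact degree_alt)
    fix vs assume "vs \<in> set ?vss"
    then obtain cs where cs: "cs \<in> set css" "vs = weave q cs" by auto
    \<comment> \<open>A fixed point of \<open>\<sigma>\<close> would be an edge common to both
      matchings; excluding it gives woven lists of length at least 4.\<close>
    have len: "length cs \<ge> 2"
    proof (rule ccontr)
      assume "\<not> length cs \<ge> 2"
      moreover have "length cs \<noteq> 0" using cs ne by auto
      ultimately have "length cs = 1" by linarith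
      then have "\<sigma> (cs ! 0) = cs ! 0" and a: "cs ! 0 \<in> A"
        using step[OF cs(1), of 0] sub[OF cs(1)] nth_mem[of 0 cs] by auto
      then show False using pq[OF a] neq[OF a] by simp
    qed
    then show "3 \<le> length vs" using cs by simp
    show "edges (circuit_of vs) \<subseteq> edges (alternating_graph A p q)"
    proof
      fix e assume "e \<in> edges (circuit_of vs)"
      then obtain j where j: "j < 2 * length cs" "e = {vs ! j, vs ! (Suc j mod (2 * length cs))}"
        by (auto simp: circuit_of_def cs)
      define i where "i = j div 2"
      have i: "i < length cs" using j(1) by (simp add: i_def)
      then have a: "cs ! i \<in> A" using sub[OF cs(1)] by auto
      show "e \<in> edges (alternating_graph A p q)"
      proof (cases "even j")
        case True
        then have "j = 2 * i" by (simp add: i_def)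
        then have "e = {cs ! i, q (cs ! i)}"
          using j(2) i by (simp add: cs weave_nth)
        then show ?thesis using a by (simp add: alternating_graph_def)
      next
        case False
        then have ji: "j = Suc (2 * i)" by (simp add: i_def)
        define k where "k = Suc i mod length cs"
        have k: "k < length cs" using i unfolding k_def by (intro mod_less_divisor) auto
        have "Suc j mod (2 * length cs) = 2 * k"
          by (simp add: ji k_def mult_mod_right)
        then have "e = {cs ! k, q (cs ! i)}"
          using j(2) i k ji by (simp add: cs weave_nth insert_commute)
        moreover have "cs ! k = \<sigma> (cs ! i)"
          using step[OF cs(1) i] by (simp add: k_def)
        moreover have "cs ! k \<in> A" using sub[OF cs(1)] k by auto
        ultimately show ?thesis using pq[OF a] by (auto simp: alternating_graph_def)
      qed
    qed
  qed
  then show ?thesis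
    unfolding parity by (cases "even (card A)") simp_all
qed

text \<open>If \<open>\<sigma>\<close> belongs to \<open>p\<close> and \<open>q\<close>, then
  \<open>inv \<rho> \<circ> \<sigma> \<circ> \<rho>'\<close> belongs to the switched pair. Signs
  multiply, so the unknown sign of \<open>\<sigma>\<close> drops out and the opposite signs of
  \<open>\<rho>\<close> and \<open>\<rho>'\<close> decide.\<close>

lemma switch_not_pseudo:
  assumes "alternating A B p q"
    and \<rho>: "\<rho> permutes A" "\<rho>' permutes A" "evenperm \<rho> \<noteq> evenperm \<rho>'"
    and neq': "\<And>a. a \<in> A \<Longrightarrow> p (\<rho> a) \<noteq> q (\<rho>' a)"
    and V: "verts G = A \<union> B"
    and E: "\<And>a. a \<in> A \<Longrightarrow> {a, p a} \<in> edges G" "\<And>a. a \<in> A \<Longrightarrow> {a, q a} \<in> edges G"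
      "\<And>a. a \<in> A \<Longrightarrow> {a, p (\<rho> a)} \<in> edges G" "\<And>a. a \<in> A \<Longrightarrow> {a, q (\<rho>' a)} \<in> edges G"
  shows "\<not> pseudo_two_factor_isomorphic G"
proof -
  interpret alternating A B p q by fact
  interpret alt': alternating A B "p \<circ> \<rho>" "q \<circ> \<rho>'"
    by unfold_locales
      (use fin disj neq' bij_betw_trans[OF permutes_imp_bij p] bij_betw_trans[OF permutes_imp_bij q] \<rho> in auto)
  define \<sigma> where "\<sigma> a = (if a \<in> A then inv_into A p (q a) else a)" for a
  have "bij_betw (inv_into A p \<circ> q) A A"
    by (rule bij_betw_trans[OF q bij_betw_inv_into[OF p]])
  then have "bij_betw \<sigma> A A"
    by (rule bij_betw_cong[THEN iffD1, rotated]) (simp add: \<sigma>_def)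
  then have \<sigma>: "\<sigma> permutes A"
    by (rule bij_imp_permutes) (simp add: \<sigma>_def)
  have p\<sigma>: "p (\<sigma> a) = q a" if "a \<in> A" for a
    using that p in_B(2)[OF that] by (simp add: \<sigma>_def bij_betw_def f_inv_into_f)
  let ?\<sigma>' = "inv \<rho> \<circ> \<sigma> \<circ> \<rho>'"
  have \<sigma>': "?\<sigma>' permutes A"
    by (intro permutes_compose permutes_inv \<rho> \<sigma>)
  have "(p \<circ> \<rho>) (?\<sigma>' a) = (q \<circ> \<rho>') a" if "a \<in> A" for a
    using that \<rho> p\<sigma> by (simp add: permutes_inverses permutes_in_image)
  note alt = alt'.even_num_circuits[OF \<sigma>' this]
  have perm: "permutation \<rho>" "permutation \<rho>'" "permutation \<sigma>"
    using \<rho> \<sigma> fin by (auto intro: permutation_permutes[THEN iffD2])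
  have "evenperm ?\<sigma>' \<longleftrightarrow> (evenperm \<rho> = evenperm \<sigma>) = evenperm \<rho>'"
    using perm by (simp del: comp_apply add: evenperm_comp evenperm_inv permutation_compose permutation_inverse)
  then have neq_parity: "even (num_circuits (alternating_graph A p q)) \<noteq>
      even (num_circuits (alternating_graph A (p \<circ> \<rho>) (q \<circ> \<rho>')))"
    using even_num_circuits[OF \<sigma> p\<sigma>] alt \<rho>(3) by blast
  have "two_factor (alternating_graph A p q) G"
    by (rule two_factor_alt) (use V E in auto)
  moreover have "two_factor (alternating_graph A (p \<circ> \<rho>) (q \<circ> \<rho>')) G"
    by (rule alt'.two_factor_alt) (use V E in auto)
  ultimately show ?thesis
    using neq_parity unfolding pseudo_two_factor_isomorphic_def by fast
qed

section \<open>The graphs $T_i(n)$\<close>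

text \<open>The colour classes put \<open>Tt i 2\<close> on the black and \<open>Tt i 1\<close> on
  the white side, so a clause for \<open>Tt i j\<close> in the matchings below concerns
  \<open>j = 2\<close>, and in their inverses \<open>j = 1\<close>.\<close>

definition T_black :: "nat \<Rightarrow> T_vertex set" where
  "T_black n = (\<Union>i\<in>{1..n}. (\<Union>j\<in>{1, 2, 3}. {Tu i j, Tx i j, Tz i j}) \<union> {Tt i 2})"

definition T_white :: "nat \<Rightarrow> T_vertex set" where
  "T_white n = (\<Union>i\<in>{1..n}. (\<Union>j\<in>{1, 2, 3}. {Tw i j, Ty i j, Tv i j}) \<union> {Tt i 1})"

lemma T_verts: "verts (T_graph n) = T_black n \<union> T_white n"
  unfolding T_graph_def segment_verts_def T_black_def T_white_def by (simp, blast)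

lemma finite_T_black: "finite (T_black n)"
  by (simp add: T_black_def)

lemma T_black_white_disjoint: "T_black n \<inter> T_white n = {}"
  by (auto simp: T_black_def T_white_def)

text \<open>The perfect matching \<open>T_p\<close> stays inside the segments, and consecutive segments are linked in
  \<open>T_q\<close> only by the edges at \<open>u\<^sup>2\<close>.\<close>

fun T_p :: "T_vertex \<Rightarrow> T_vertex" where
  "T_p (Tu i j) = Tw i (if j = 1 then 1 else if j = 2 then 3 else 2)"
| "T_p (Tx i j) = (if j = 2 then Tt i 1 else Ty i j)"
| "T_p (Tz i j) = (if j = 3 then Ty i 2 else Tv i j)"
| "T_p (Tt i j) = Tv i 3"
| "T_p v = v"

fun T_p_inv :: "T_vertex \<Rightarrow> T_vertex" where
  "T_p_inv (Tw i j) = Tu i (if j = 1 then 1 else if j = 2 then 3 else 2)"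
| "T_p_inv (Ty i j) = (if j = 2 then Tz i 3 else Tx i j)"
| "T_p_inv (Tv i j) = (if j = 3 then Tt i 2 else Tz i j)"
| "T_p_inv (Tt i j) = Tx i 2"
| "T_p_inv v = v"

fun T_q :: "nat \<Rightarrow> T_vertex \<Rightarrow> T_vertex" where
  "T_q n (Tu i j) = (if j = 1 then Tw i 2 else if j = 2 then Tv (if i = 1 then n else i - 1) 2 else Tw i 3)"
| "T_q n (Tx i j) = (if j = 1 then Tw i 1 else if j = 2 then Ty i 2 else Tt i 1)"
| "T_q n (Tz i j) = (if j = 1 then Ty i 1 else if j = 2 then Ty i 3 else Tv i 3)"
| "T_q n (Tt i j) = Tv i 1"
| "T_q n v = v"

fun T_q_inv :: "nat \<Rightarrow> T_vertex \<Rightarrow> T_vertex" where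
  "T_q_inv n (Tw i j) = (if j = 1 then Tx i 1 else if j = 2 then Tu i 1 else Tu i 3)"
| "T_q_inv n (Ty i j) = (if j = 1 then Tz i 1 else if j = 2 then Tx i 2 else Tz i 2)"
| "T_q_inv n (Tv i j) = (if j = 1 then Tt i 2 else if j = 2 then Tu (if i = n then 1 else Suc i) 2 else Tz i 3)"
| "T_q_inv n (Tt i j) = Tx i 3"
| "T_q_inv n v = v"

text \<open>In \<open>T3_graph\<close> the vertex \<open>Tv n 2\<close> is joined to
  \<open>Tu 1 3\<close> instead of \<open>Tu 1 2\<close>. The matching is rerouted through the u, w,
  x vertices and \<open>Tt 1 1\<close> of the first segment; its values at \<open>Tz\<close> and
  \<open>Tt 1 2\<close>, where the switch takes place, remain those of \<open>T_q\<close>.\<close>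

fun T3_q :: "nat \<Rightarrow> T_vertex \<Rightarrow> T_vertex" where
  "T3_q n (Tu i j) = (if i = 1 then if j = 1 then Tw 1 2 else if j = 2 then Tw 1 1 else Tv n 2 else T_q n (Tu i j))"
| "T3_q n (Tx i j) = (if i = 1 then if j = 1 then Tt 1 1 else if j = 2 then Ty 1 2 else Tw 1 3 else T_q n (Tx i j))"
| "T3_q n v = T_q n v"

fun T3_q_inv :: "nat \<Rightarrow> T_vertex \<Rightarrow> T_vertex" where
  "T3_q_inv n (Tw i j) = (if i = 1 then if j = 1 then Tu 1 2 else if j = 2 then Tu 1 1 else Tx 1 3 else T_q_inv n (Tw i j))"
| "T3_q_inv n (Tt i j) = (if i = 1 then Tx 1 1 else T_q_inv n (Tt i j))"
| "T3_q_inv n (Tv i j) = (if i = n \<and> j = 2 then Tu 1 3 else T_q_inv n (Tv i j))"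
| "T3_q_inv n v = T_q_inv n v"

lemma bij_T_p: "bij_betw T_p (T_black n) (T_white n)"
  by (rule bij_betw_byWitness[where f' = T_p_inv]) (auto simp: T_black_def T_white_def)

lemma bij_T_q: "bij_betw (T_q n) (T_black n) (T_white n)"
  by (rule bij_betw_byWitness[where f' = "T_q_inv n"]) (auto simp: T_black_def T_white_def)

lemma bij_T3_q: "bij_betw (T3_q n) (T_black n) (T_white n)"
  by (rule bij_betw_byWitness[where f' = "T3_q_inv n"]) (auto simp: T_black_def T_white_def)

lemma segment_edge: "e \<in> segment_edges i \<Longrightarrow> i \<in> {1..n} \<Longrightarrow> e \<in> edges (T_graph n)"
  by (auto simp: T_graph_def)

lemma T_p_edge: "a \<in> T_black n \<Longrightarrow> {a, T_p a} \<in> edges (T_graph n)"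
  unfolding T_black_def
  by (auto intro!: segment_edge simp: segment_edges_def doubleton_eq_iff)

lemma T_q_edge:
  assumes "a \<in> T_black n" "a \<noteq> Tu 1 2"
  shows "{a, T_q n a} \<in> edges (T_graph n)"
proof (cases "\<exists>i. a = Tu i 2")
  case True
  then obtain i where i: "a = Tu i 2" by blast
  then have "i \<in> {1..n}" "i \<noteq> 1" using assms by (auto simp: T_black_def)
  then have "i \<in> {2..n}" by auto
  with i show ?thesis by (auto simp: T_graph_def insert_commute)
next
  case False
  with assms show ?thesis
    unfolding T_black_def
    by (auto intro!: segment_edge simp: segment_edges_def doubleton_eq_iff)
qed

lemma T3_q_edge:
  assumes "a \<in> T_black n" "a \<noteq> Tu 1 3"
  shows "{a, T3_q n a} \<in> edges (T_graph n)"
proof (cases "T3_q n a = T_q n a \<and> a \<noteq> Tu 1 2")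
  case True
  then show ?thesis using assms T_q_edge by auto
next
  case False
  then have "a \<in> {Tu 1 1, Tu 1 2, Tx 1 1, Tx 1 2, Tx 1 3}"
    using assms by (auto simp: T_black_def split: if_splits)
  then show ?thesis
    using assms(1) by (auto intro!: segment_edge simp: segment_edges_def doubleton_eq_iff T_black_def)
qed

text \<open>The switch involves only the four black vertices \<open>Tz 1 1\<close>,
  \<open>Tz 1 2\<close>, \<open>Tz 1 3\<close>, \<open>Tt 1 2\<close>. The assumptions
  \<open>q1\<close> fix \<open>q\<close> there, so the way in which the segments are closed up does
  not influence it.\<close>

lemma T_not_pseudo:
  assumes n: "n \<ge> 1"
    and G: "verts G = verts (T_graph n)" "edges (T_graph n) \<subseteq> edges G"
    and q: "bij_betw q (T_black n) (T_white n)" "\<And>a. a \<in> T_black n \<Longrightarrow> {a, q a} \<in> edges G"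
      "\<And>a. a \<in> T_black n \<Longrightarrow> T_p a \<noteq> q a"
    and q1: "q (Tz 1 1) = Ty 1 1" "q (Tz 1 2) = Ty 1 3" "q (Tz 1 3) = Tv 1 3" "q (Tt 1 2) = Tv 1 1"
  shows "\<not> pseudo_two_factor_isomorphic G"
proof -
  \<comment> \<open>On z1, z2, z3, t2 the partners under \<open>T_p\<close> change from v1, v2, y2,
    v3 to y2, v2, v3, v1, and those under \<open>q\<close> from y1, y3, v3, v1 to v1, y1, y3, v3.
    The first change is an even 3-cycle, the second an odd 4-cycle.\<close>
  let ?cs = "[Tz 1 1, Tz 1 3, Tt 1 2]"
  let ?cs' = "[Tz 1 1, Tt 1 2, Tz 1 3, Tz 1 2]"
  define \<rho> \<rho>' where \<rho>_def: "\<rho> = cycle_of_list ?cs" and \<rho>'_def: "\<rho>' = cycle_of_list ?cs'"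
  have sub: "set ?cs \<subseteq> T_black n" "set ?cs' \<subseteq> T_black n"
    using n by (auto simp: T_black_def)
  have [simp]: "\<rho> (Tz 1 1) = Tz 1 3" "\<rho> (Tz 1 2) = Tz 1 2" "\<rho> (Tz 1 3) = Tt 1 2" "\<rho> (Tt 1 2) = Tz 1 1"
    "\<rho>' (Tz 1 1) = Tt 1 2" "\<rho>' (Tz 1 2) = Tz 1 1" "\<rho>' (Tz 1 3) = Tz 1 2" "\<rho>' (Tt 1 2) = Tz 1 3"
    by (auto simp: \<rho>_def \<rho>'_def transpose_def)
  have fixed: "\<rho> a = a" "\<rho>' a = a" if "a \<notin> {Tz 1 1, Tz 1 2, Tz 1 3, Tt 1 2}" for a
    using that unfolding \<rho>_def \<rho>'_def by (auto intro!: id_outside_supp)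
  have "alternating (T_black n) (T_white n) T_p q"
    by unfold_locales (use finite_T_black T_black_white_disjoint bij_T_p q in auto)
  then show ?thesis
  proof (rule switch_not_pseudo)
    show "\<rho> permutes T_black n" "\<rho>' permutes T_black n"
      unfolding \<rho>_def \<rho>'_def using cycle_permutes sub by (blast intro: permutes_subset)+
    show "evenperm \<rho> \<noteq> evenperm \<rho>'"
      unfolding \<rho>_def \<rho>'_def using evenperm_cycle_of_list[of ?cs] evenperm_cycle_of_list[of ?cs'] by simp
    show "verts G = T_black n \<union> T_white n"
      using G T_verts by simp
    fix a assume a: "a \<in> T_black n"
    show "{a, T_p a} \<in> edges G" using T_p_edge[OF a] G by blast
    show "{a, q a} \<in> edges G" using q(2)[OF a] .
    have seg: "e \<in> segment_edges 1 \<Longrightarrow> e \<in> edges G" for e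
      using segment_edge[of e 1 n] n G by auto
    show "T_p (\<rho> a) \<noteq> q (\<rho>' a)"
    proof (cases "a \<in> {Tz 1 1, Tz 1 2, Tz 1 3, Tt 1 2}")
      case True
      then show ?thesis using q1 by (auto simp del: One_nat_def)
    next
      case False
      then show ?thesis using fixed[OF False] q(3)[OF a] by simp
    qed
    show "{a, T_p (\<rho> a)} \<in> edges G"
    proof (cases "a \<in> {Tz 1 1, Tz 1 2, Tz 1 3, Tt 1 2}")
      case True
      then show ?thesis
        by (auto simp del: One_nat_def intro!: seg simp: segment_edges_def doubleton_eq_iff)
    next
      case False
      then show ?thesis using fixed[OF False] T_p_edge[OF a] G by auto
    qed
    show "{a, q (\<rho>' a)} \<in> edges G"
    proof (cases "a \<in> {Tz 1 1, Tz 1 2, Tz 1 3, Tt 1 2}")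
      case True
      then show ?thesis
        using q1 by (auto simp del: One_nat_def intro!: seg simp: segment_edges_def doubleton_eq_iff)
    next
      case False
      then show ?thesis using fixed[OF False] q(2)[OF a] by simp
    qed
  qed
qed

text \<open>Both closings contain the edge between \<open>Tu 1 2\<close> and \<open>Tv n 2\<close>,
  the only closing edge that \<open>T_q\<close> uses.\<close>

lemma T1_T2_not_pseudo:
  assumes n: "n \<ge> 1"
    and G: "verts G = verts (T_graph n)" "edges (T_graph n) \<subseteq> edges G" "{Tu 1 2, Tv n 2} \<in> edges G"
  shows "\<not> pseudo_two_factor_isomorphic G"
proof (rule T_not_pseudo[OF n G(1,2) bij_T_q])
  fix a assume a: "a \<in> T_black n"
  show "{a, T_q n a} \<in> edges G"
    using T_q_edge[OF a] G by (cases "a = Tu 1 2") auto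
  show "T_p a \<noteq> T_q n a"
    using a by (auto simp: T_black_def)
qed auto

lemma T3_not_pseudo:
  assumes n: "n \<ge> 1"
  shows "\<not> pseudo_two_factor_isomorphic (T3_graph n)"
proof (rule T_not_pseudo[OF n _ _ bij_T3_q])
  fix a assume a: "a \<in> T_black n"
  show "{a, T3_q n a} \<in> edges (T3_graph n)"
    using T3_q_edge[OF a] by (cases "a = Tu 1 3") (auto simp: T3_graph_def)
  show "T_p a \<noteq> T3_q n a"
    using a by (auto simp: T_black_def split: if_split_asm)
qed (auto simp: T3_graph_def)

lemma T_graphs_not_pseudo:
  assumes "n \<ge> 1"
  shows "\<not> pseudo_two_factor_isomorphic (T1_graph n)" "\<not> pseudo_two_factor_isomorphic (T2_graph n)"
    "\<not> pseudo_two_factor_isomorphic (T3_graph n)"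
proof -
  show "\<not> pseudo_two_factor_isomorphic (T1_graph n)"
    by (rule T1_T2_not_pseudo[OF assms]) (auto simp: T1_graph_def)
  show "\<not> pseudo_two_factor_isomorphic (T2_graph n)"
    by (rule T1_T2_not_pseudo[OF assms]) (auto simp: T2_graph_def)
qed (rule T3_not_pseudo[OF assms])

section \<open>The graphs $D(n)$\<close>

text \<open>Line \<open>j\<close> is the number \<open>j\<close> and point \<open>x\<close> is
  \<open>n + x\<close>, so a perfect matching is a choice of shifts 0, 1, 3, one for each
  line.\<close>

definition D_nat :: "nat \<Rightarrow> nat graph" where
  "D_nat n = \<lparr>verts = {..<2 * n}, edges = {{j, n + (j + s) mod n} | j s. j < n \<and> s \<in> {0, 1, 3}}\<rparr>"

lemma bij_betw_add_lessThan: "bij_betw ((+) n) {..<n} {n..<2 * n}" for n :: nat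
  by (simp add: bij_betw_def lessThan_atLeast0 image_add_atLeastLessThan mult_2)

lemma mod_less_add: "a < n + n \<Longrightarrow> a mod n = (if a < n then a else a - n)" for a n :: nat
  by (simp add: mod_if)

text \<open>\<open>s\<close> and \<open>t\<close> are the shifts of the two original matchings,
  \<open>s'\<close> and \<open>t'\<close> those after the switch; the latter are bijective because
  the \<open>switch\<close> equations present them as the former composed with \<open>\<rho>\<close>
  and \<open>\<rho>'\<close>.\<close>

lemma D_nat_not_pseudo:
  assumes n: "n \<ge> 7"
    and shifts: "\<And>j. j < n \<Longrightarrow> {s j, t j, s' j, t' j} \<subseteq> {0, 1, 3}"
      "\<And>j. j < n \<Longrightarrow> s j \<noteq> t j" "\<And>j. j < n \<Longrightarrow> s' j \<noteq> t' j"
    and inj: "inj_on (\<lambda>j. (j + s j) mod n) {..<n}" "inj_on (\<lambda>j. (j + t j) mod n) {..<n}"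
    and \<rho>: "\<rho> permutes {..<n}" "\<rho>' permutes {..<n}" "evenperm \<rho> \<noteq> evenperm \<rho>'"
    and switch: "\<And>j. j < n \<Longrightarrow> (\<rho> j + s (\<rho> j)) mod n = (j + s' j) mod n"
      "\<And>j. j < n \<Longrightarrow> (\<rho>' j + t (\<rho>' j)) mod n = (j + t' j) mod n"
  shows "\<not> pseudo_two_factor_isomorphic (D_nat n)"
proof -
  let ?p = "\<lambda>s j. n + (j + s j) mod n"
  have edge: "{j, ?p r j} \<in> edges (D_nat n)" if "j < n" "r j \<in> {0, 1, 3}" for j r
    using that by (auto simp: D_nat_def)
  have neq: "?p r j \<noteq> ?p r' j" if "j < n" "r j \<in> {0, 1, 3}" "r' j \<in> {0, 1, 3}" "r j \<noteq> r' j" for r r' j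
    using that n by (auto simp: mod_less_add split: if_splits)
  have bij: "bij_betw (?p r) {..<n} {n..<2 * n}" if "inj_on (\<lambda>j. (j + r j) mod n) {..<n}" for r
  proof -
    have "(\<lambda>j. (j + r j) mod n) ` {..<n} \<subseteq> {..<n}" using n by auto
    then have "bij_betw (\<lambda>j. (j + r j) mod n) {..<n} {..<n}"
      using that by (simp add: bij_betw_def endo_inj_surj)
    from bij_betw_trans[OF this bij_betw_add_lessThan] show ?thesis by (simp add: o_def)
  qed
  have "alternating {..<n} {n..<2 * n} (?p s) (?p t)"
    by unfold_locales (use bij inj neq shifts in auto)
  then show ?thesis
  proof (rule switch_not_pseudo[OF _ \<rho>])
    fix j assume "j \<in> {..<n}"
    then have j: "j < n" by simp
    note sw = switch[OF j]
    show "?p s (\<rho> j) \<noteq> ?p t (\<rho>' j)"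
      using neq[OF j, of s' t'] shifts[OF j] unfolding sw by simp
    show "{j, ?p s j} \<in> edges (D_nat n)" "{j, ?p t j} \<in> edges (D_nat n)"
      using edge[OF j] shifts(1)[OF j] by auto
    show "{j, ?p s (\<rho> j)} \<in> edges (D_nat n)" "{j, ?p t (\<rho>' j)} \<in> edges (D_nat n)"
      unfolding sw using edge[OF j] shifts(1)[OF j] by auto
  qed (auto simp: D_nat_def)
qed

section \<open>Perfect matchings of D(n) as words of shifts: a window followed by blocks 111 and
  303\<close>

definition shift_seq :: "nat list \<Rightarrow> (nat \<Rightarrow> nat) \<Rightarrow> nat \<Rightarrow> nat" where
  "shift_seq xs r j = (if j < length xs then xs ! j else r (j - length xs))"

abbreviation ones :: "nat \<Rightarrow> nat" where "ones m \<equiv> 1"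

definition three_zero_three :: "nat \<Rightarrow> nat" where
  "three_zero_three m = (if m mod 3 = 1 then 0 else 3)"

text \<open>Window and tail together take values in \<open>{1..n}\<close>, a complete system of
  residues modulo \<open>n\<close>.\<close>

lemma inj_shift_ones:
  assumes dist: "distinct (map (\<lambda>j. j + xs ! j) [0..<length xs])"
    and range: "\<And>j. j < length xs \<Longrightarrow> j + xs ! j \<in> {1..length xs}"
    and n: "n \<ge> length xs"
  shows "inj_on (\<lambda>j. (j + shift_seq xs ones j) mod n) {..<n}"
proof -
  let ?v = "\<lambda>j. j + shift_seq xs ones j"
  have win: "?v j \<in> {1..length xs}" if "j < length xs" for j
    using range[OF that] that by (simp add: shift_seq_def)
  have tail: "?v j = Suc j" if "j \<ge> length xs" for j
    using that by (simp add: shift_seq_def)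
  have "inj_on ?v {..<length xs}"
    using dist by (auto simp: distinct_map inj_on_def shift_seq_def)
  then have "inj_on ?v {..<n}"
    using win tail by (smt (verit) Suc_inject Suc_leI atLeastAtMost_iff inj_on_def le_trans lessThan_iff not_less not_less_eq_eq)
  moreover have "inj_on (\<lambda>a. a mod n) (?v ` {..<n})"
  proof (rule inj_on_subset)
    show "?v ` {..<n} \<subseteq> {1..n}"
    proof safe
      fix j assume "j < n"
      then show "?v j \<in> {1..n}" using win[of j] tail[of j] n by (cases "j < length xs") auto
    qed
    show "inj_on (\<lambda>a. a mod n) {1..n}"
      by (auto simp: inj_on_def mod_less_add split: if_splits)
  qed
  ultimately have "inj_on ((\<lambda>a. a mod n) \<circ> ?v) {..<n}" by (rule comp_inj_on)
  then show ?thesis by (simp add: o_def)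
qed

text \<open>The window skips 2 and \<open>length xs + 1\<close> but takes
  \<open>length xs + 2\<close>; a tail of blocks 303 begins with \<open>length xs + 1\<close> and
  omits exactly \<open>length xs + 2\<close>. In total the values lie in
  \<open>{1, n + 2} \<union> {3..n}\<close>, again a complete system of residues: 2 is reached by
  wrapping around.\<close>

lemma inj_shift_three_zero_three:
  assumes dist: "distinct (map (\<lambda>j. j + xs ! j) [0..<length xs])"
    and range: "\<And>j. j < length xs \<Longrightarrow> j + xs ! j \<in> {1, length xs + 2} \<union> {3..length xs}"
    and n: "n = length xs + 3 * k" "length xs \<ge> 3"
  shows "inj_on (\<lambda>j. (j + shift_seq xs three_zero_three j) mod n) {..<n}"
proof -
  let ?W = "length xs"
  let ?v = "\<lambda>j. j + shift_seq xs three_zero_three j"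
  have win: "?v j \<in> {1, ?W + 2} \<union> {3..?W}" if "j < ?W" for j
    using range[OF that] that by (simp add: shift_seq_def)
  have tail: "?v (?W + m) = ?W + (m + three_zero_three m)" for m
    by (simp add: shift_seq_def)
  have tail_range: "m + three_zero_three m \<noteq> 0" "m + three_zero_three m \<noteq> 2" 
     "m < 3 * k \<Longrightarrow> m + three_zero_three m \<noteq> 3 * k + 1 \<and> m + three_zero_three m \<le> 3 * k + 2" for m
    unfolding three_zero_three_def by (cases "m = 0"; simp; presburger)+
  have tail_inj: "m = m'" if "m + three_zero_three m = m' + three_zero_three m'" for m m'
    using that unfolding three_zero_three_def by (simp split: if_splits; presburger)
  have "inj_on ?v {..<n}"
  proof (rule inj_onI)
    fix i j assume ij: "i \<in> {..<n}" "j \<in> {..<n}" "?v i = ?v j"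
    have sep: False if "i < ?W" "?v i = ?v (?W + m)" for i m
      using win[OF that(1)] that(2) tail_range(1,2)[of m] n(2) unfolding tail by auto
    consider "i < ?W" "j < ?W" | m where "i < ?W" "j = ?W + m" | m where "j < ?W" "i = ?W + m"
      | m m' where "i = ?W + m" "j = ?W + m'"
      by (metis le_iff_add not_less)
    then show "i = j"
    proof cases
      case 1
      then show ?thesis using dist ij(3) by (auto simp: distinct_map inj_on_def shift_seq_def)
    next
      case 4
      then show ?thesis using ij(3) tail_inj unfolding tail by (metis add_left_cancel tail)
    qed (use sep ij(3) in metis)+
  qed
  moreover have "inj_on (\<lambda>a. a mod n) (?v ` {..<n})"
  proof (rule inj_on_subset)
    show "?v ` {..<n} \<subseteq> {1, n + 2} \<union> {3..n}"
    proof
      fix a assume "a \<in> ?v ` {..<n}"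
      then obtain j where j: "j < n" "a = ?v j" by auto
      show "a \<in> {1, n + 2} \<union> {3..n}"
      proof (cases "j < ?W")
        case True
        \<comment> \<open>The window value \<open>?W + 2\<close> is \<open>n + 2\<close> if
          \<open>k = 0\<close> and lies in \<open>{3..n}\<close> otherwise.\<close>
        then show ?thesis using win[OF True] j n by (cases k) auto
      next
        case False
        then obtain m where m: "j = ?W + m" by (metis le_iff_add not_less)
        then show ?thesis
          using tail_range[of m] j n unfolding tail j(2) m by auto
      qed
    qed
    show "inj_on (\<lambda>a. a mod n) ({1, n + 2} \<union> {3..n})"
      using n(2) by (auto simp: inj_on_def mod_less_add n(1) split: if_splits)
  qed
  ultimately have "inj_on ((\<lambda>a. a mod n) \<circ> ?v) {..<n}" by (rule comp_inj_on)
  then show ?thesis by (simp add: o_def)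
qed

text \<open>An executable form of the two window conditions above together with the switch
  equations. These hold without reduction modulo \<open>n\<close>, so they are independent of
  \<open>n\<close>.\<close>

definition window_check :: "nat list \<Rightarrow> nat list \<Rightarrow> nat list \<Rightarrow> nat list \<Rightarrow> (nat \<Rightarrow> nat) \<Rightarrow> (nat \<Rightarrow> nat) \<Rightarrow> bool" where
  "window_check xs ys xs' ys' \<rho> \<rho>' \<longleftrightarrow>
     length ys = length xs \<and> length xs' = length xs \<and> length ys' = length xs \<and>
     distinct (map (\<lambda>j. j + xs ! j) [0..<length xs]) \<and>
     distinct (map (\<lambda>j. j + ys ! j) [0..<length xs]) \<and>
     (\<forall>j\<in>set [0..<length xs]. {xs ! j, ys ! j, xs' ! j, ys' ! j} \<subseteq> {0, 1, 3} \<and>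
        xs ! j \<noteq> ys ! j \<and> xs' ! j \<noteq> ys' ! j \<and>
        1 \<le> j + xs ! j \<and> j + xs ! j \<le> length xs \<and>
        1 \<le> j + ys ! j \<and> j + ys ! j \<le> length xs + 2 \<and> j + ys ! j \<noteq> 2 \<and> j + ys ! j \<noteq> length xs + 1 \<and>
        \<rho> j < length xs \<and> \<rho>' j < length xs \<and>
        \<rho> j + xs ! (\<rho> j) = j + xs' ! j \<and> \<rho>' j + ys ! (\<rho>' j) = j + ys' ! j)"

text \<open>Both 2-factors have the same tail of \<open>k\<close> blocks and the permutations fix it
  pointwise, so one evaluation on the window covers every \<open>k\<close>.\<close>

lemma D_nat_window_not_pseudo:
  assumes check: "window_check xs ys xs' ys' \<rho> \<rho>'"
    and W: "length xs \<ge> 7" and n: "n = length xs + 3 * k"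
    and \<rho>: "\<rho> permutes {..<length xs}" "\<rho>' permutes {..<length xs}" "evenperm \<rho> \<noteq> evenperm \<rho>'"
  shows "\<not> pseudo_two_factor_isomorphic (D_nat n)"
proof -
  let ?W = "length xs"
  have len: "length ys = ?W" "length xs' = ?W" "length ys' = ?W"
    and dist: "distinct (map (\<lambda>j. j + xs ! j) [0..<?W])" "distinct (map (\<lambda>j. j + ys ! j) [0..<length ys])"
    using check by (auto simp: window_check_def)
  have win: "{xs ! j, ys ! j, xs' ! j, ys' ! j} \<subseteq> {0, 1, 3}"
        "xs ! j \<noteq> ys ! j" "xs' ! j \<noteq> ys' ! j"
        "1 \<le> j + xs ! j" "j + xs ! j \<le> ?W"
        "1 \<le> j + ys ! j" "j + ys ! j \<le> ?W + 2" "j + ys ! j \<noteq> 2" "j + ys ! j \<noteq> ?W + 1"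
        "\<rho> j < ?W" "\<rho>' j < ?W"
        "\<rho> j + xs ! (\<rho> j) = j + xs' ! j" "\<rho>' j + ys ! (\<rho>' j) = j + ys' ! j" if "j < ?W" for j
    using check that by (auto simp: window_check_def)
  have fixed: "\<rho> j = j" "\<rho>' j = j" if "\<not> j < ?W" for j
    using \<rho> that by (auto simp: permutes_def)
  show ?thesis
  proof (rule D_nat_not_pseudo)
    show "\<rho> permutes {..<n}" "\<rho>' permutes {..<n}"
      using \<rho> n by (auto intro: permutes_subset)
    show "inj_on (\<lambda>j. (j + shift_seq xs ones j) mod n) {..<n}"
      using dist(1) win(4,5) n by (intro inj_shift_ones) auto
    show "inj_on (\<lambda>j. (j + shift_seq ys three_zero_three j) mod n) {..<n}"
    proof (rule inj_shift_three_zero_three[OF dist(2)])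
      fix j assume "j < length ys"
      then show "j + ys ! j \<in> {1, length ys + 2} \<union> {3..length ys}"
        using win(6-9)[of j] unfolding len by auto
    qed (use n W len in auto)
    fix j
    show "{shift_seq xs ones j, shift_seq ys three_zero_three j, shift_seq xs' ones j,
             shift_seq ys' three_zero_three j} \<subseteq> {0, 1, 3}"
      using win(1)[of j] by (auto simp: shift_seq_def len three_zero_three_def)
    show "shift_seq xs ones j \<noteq> shift_seq ys three_zero_three j"
      "shift_seq xs' ones j \<noteq> shift_seq ys' three_zero_three j"
      using win(2,3)[of j] by (auto simp: shift_seq_def len three_zero_three_def)
    show "(\<rho> j + shift_seq xs ones (\<rho> j)) mod n = (j + shift_seq xs' ones j) mod n"
      "(\<rho>' j + shift_seq ys three_zero_three (\<rho>' j)) mod n = (j + shift_seq ys' three_zero_three j) mod n"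
      using win(10-13)[of j] fixed[of j] by (cases "j < ?W"; simp add: shift_seq_def len)+
  qed (use n W \<rho> in auto)
qed

lemma cycle_of_list_permutes_subset: "set cs \<subseteq> S \<Longrightarrow> cycle_of_list cs permutes S"
  using cycle_permutes permutes_subset by blast

text \<open>Lines are matched to points block by block, with shifts \<open>111/303\<close>, \<open>3001/1313\<close> or
  \<open>30011/13303\<close> in the two perfect matchings. The sign depends only on \<open>n\<close> and on the parity of the
  number of blocks of length 5, hence \<open>8 = 4 + 4 = 5 + 3\<close>, \<open>9 = 3 + 3 + 3 = 4 + 5\<close> and
  \<open>13 = 3 + 3 + 3 + 4 = 4 + 5 + 4\<close> yield 2-factors of different parities.\<close>

lemma D_nat_8_not_pseudo: "\<not> pseudo_two_factor_isomorphic (D_nat (8 + 3 * k))"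
proof (rule D_nat_window_not_pseudo)
  \<comment> \<open>The permutations are forced by the words: since the values
    \<open>j + xs ! j\<close> are distinct, \<open>\<rho> j\<close> is the only line whose old point
    is the new point of \<open>j\<close>; likewise for \<open>\<rho>'\<close>.\<close>
  show "window_check [3,0,0,1,3,0,0,1] [1,3,1,3,1,3,1,3] [3,0,0,1,1,1,1,1] [1,3,3,0,3,3,0,3]
    (cycle_of_list [4,5,6]) (cycle_of_list [2,4,6,3])"
    by code_simp
  show "evenperm (cycle_of_list [4,5,6 :: nat]) \<noteq> evenperm (cycle_of_list [2,4,6,3 :: nat])"
    using evenperm_cycle_of_list[of "[4,5,6 :: nat]"] evenperm_cycle_of_list[of "[2,4,6,3 :: nat]"] by simp
qed (auto intro!: cycle_of_list_permutes_subset simp del: cycle_of_list.simps)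

lemma evenperm_two_cycles:
  "\<not> evenperm (cycle_of_list [0,1,4,2 :: nat])"
  "evenperm (cycle_of_list [0,2,1 :: nat] \<circ> cycle_of_list [4,6,5])"
  using evenperm_cycle_of_list[of "[0,2,1 :: nat]"] evenperm_cycle_of_list[of "[4,6,5 :: nat]"]
    evenperm_cycle_of_list[of "[0,1,4,2 :: nat]"]
    evenperm_comp[OF permutation_of_cycle permutation_of_cycle, of "[0,2,1 :: nat]" "[4,6,5]"]
  by simp_all

lemma D_nat_9_not_pseudo: "\<not> pseudo_two_factor_isomorphic (D_nat (9 + 3 * k))"
proof (rule D_nat_window_not_pseudo)
  show "window_check [1,1,1,1,1,1,1,1,1] [3,0,3,3,0,3,3,0,3] [3,0,0,1,3,0,0,1,1] [1,3,1,3,1,3,3,0,3]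
    (cycle_of_list [0,2,1] \<circ> cycle_of_list [4,6,5]) (cycle_of_list [0,1,4,2])"
    by code_simp
qed (use evenperm_two_cycles in
  \<open>auto intro!: cycle_of_list_permutes_subset permutes_compose simp del: cycle_of_list.simps\<close>)

text \<open>The words of length 9 are prolonged by the same block 3001/1313 before and after the
  switch, so the permutations remain those used there.\<close>

lemma D_nat_13_not_pseudo: "\<not> pseudo_two_factor_isomorphic (D_nat (13 + 3 * k))"
proof (rule D_nat_window_not_pseudo)
  show "window_check [1,1,1,1,1,1,1,1,1,3,0,0,1] [3,0,3,3,0,3,3,0,3,1,3,1,3]
      [3,0,0,1,3,0,0,1,1,3,0,0,1] [1,3,1,3,1,3,3,0,3,1,3,1,3]
    (cycle_of_list [0,2,1] \<circ> cycle_of_list [4,6,5]) (cycle_of_list [0,1,4,2])"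
    by code_simp
qed (use evenperm_two_cycles in
  \<open>auto intro!: cycle_of_list_permutes_subset permutes_compose simp del: cycle_of_list.simps\<close>)

text \<open>With constant shifts 1 and 0 the 2-factor is one Hamiltonian circuit; with 1 and 3 the
  shifts differ by 2, which divides 10, and two circuits arise. Passing from shift 0 to shift 3
  composes with the rotation by 3, an odd 10-cycle.\<close>

lemma D_nat_10_not_pseudo: "\<not> pseudo_two_factor_isomorphic (D_nat 10)"
proof (rule D_nat_not_pseudo[where s = "\<lambda>_. 1" and t = "\<lambda>_. 0" and s' = "\<lambda>_. 1" and t' = "\<lambda>_. 3"
      and \<rho> = id and \<rho>' = "cycle_of_list [0,3,6,9,2,5,8,1,4,7]"])
  let ?cs = "[0,3,6,9,2,5,8,1,4,7 :: nat]"
  show "cycle_of_list ?cs permutes {..<10}"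
    by (rule cycle_of_list_permutes_subset) auto
  show "evenperm id \<noteq> evenperm (cycle_of_list ?cs)"
    using evenperm_cycle_of_list[of ?cs] by simp
  have "\<forall>j\<in>set [0..<10]. (cycle_of_list ?cs j + 0) mod 10 = (j + 3) mod 10"
    by code_simp
  then show "(cycle_of_list ?cs j + 0) mod 10 = (j + 3) mod 10" if "j < 10" for j
    using that by (simp only: set_upt atLeastLessThan_iff Ball_def) simp
  show "inj_on (\<lambda>j. (j + 1) mod 10) {..<10 :: nat}"
    by (auto simp: inj_on_def mod_less_add split: if_splits)
  show "inj_on (\<lambda>j. (j + 0) mod 10) {..<10 :: nat}"
    by (auto simp: inj_on_def)
qed (auto simp: permutes_id)

lemma D_nat_not_pseudo_ge_8:
  assumes "n \<ge> 8" shows "\<not> pseudo_two_factor_isomorphic (D_nat n)"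
proof -
  have "(\<exists>k. n = 8 + 3 * k) \<or> (\<exists>k. n = 9 + 3 * k) \<or> (\<exists>k. n = 13 + 3 * k) \<or> n = 10"
    using assms by presburger
  then consider k where "n = 8 + 3 * k" | k where "n = 9 + 3 * k" | k where "n = 13 + 3 * k" | "n = 10"
    by blast
  then show ?thesis
    by cases (use D_nat_8_not_pseudo D_nat_9_not_pseudo D_nat_13_not_pseudo D_nat_10_not_pseudo in simp_all)
qed

section \<open>The Heawood and the Pappus graph\<close>

definition list_graph :: "'a list \<Rightarrow> ('a \<times> 'a) list \<Rightarrow> 'a graph" where
  "list_graph vs es = \<lparr>verts = set vs, edges = (\<lambda>(a, b). {a, b}) ` set es\<rparr>"

fun matchings :: "('a \<times> 'a) list \<Rightarrow> 'a list \<Rightarrow> 'a list \<Rightarrow> ('a \<times> 'a) list list" where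
  "matchings es [] used = [[]]"
| "matchings es (a # as) used =
     concat (map (\<lambda>e. map ((#) e) (matchings es as (snd e # used)))
       (filter (\<lambda>e. fst e = a \<and> snd e \<notin> set used) es))"

text \<open>Exhaustiveness of the enumeration, which turns the finite check into a statement about
  all 2-factors.\<close>

lemma matchings_complete:
  "distinct as \<Longrightarrow> inj_on m (set as) \<Longrightarrow> (\<And>a. a \<in> set as \<Longrightarrow> (a, m a) \<in> set es) \<Longrightarrow>
     m ` set as \<inter> set used = {} \<Longrightarrow> map (\<lambda>a. (a, m a)) as \<in> set (matchings es as used)"
proof (induction as arbitrary: used)
  case (Cons a as)
  have "map (\<lambda>a. (a, m a)) as \<in> set (matchings es as (m a # used))"
    by (rule Cons.IH) (use Cons.prems in auto)
  moreover have "(a, m a) \<in> set (filter (\<lambda>e. fst e = a \<and> snd e \<notin> set used) es)"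
    using Cons.prems by auto
  ultimately show ?case by (force intro!: bexI[of _ "(a, m a)"])
qed simp

definition neighbours :: "('a \<times> 'a) list \<Rightarrow> 'a \<Rightarrow> 'a list" where
  "neighbours es v = map snd (filter (\<lambda>e. fst e = v) es) @ map fst (filter (\<lambda>e. snd e = v) es)"

text \<open>Follows a 2-regular graph from \<open>w\<close>, never back to the previous vertex
  \<open>u\<close>, until \<open>v\<close> is reached again; the number is fuel. Its output is only
  a candidate, to be validated by \<open>odd_cycle_cover\<close>.\<close>

fun walk :: "('a \<times> 'a) list \<Rightarrow> 'a \<Rightarrow> nat \<Rightarrow> 'a \<Rightarrow> 'a \<Rightarrow> 'a list" where
  "walk es v 0 u w = []"
| "walk es v (Suc k) u w = (if w = v then [] else w # walk es v k w (hd (removeAll u (neighbours es w))))"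

fun cycles :: "('a \<times> 'a) list \<Rightarrow> nat \<Rightarrow> 'a list \<Rightarrow> 'a list list" where
  "cycles es 0 vs = []"
| "cycles es (Suc k) [] = []"
| "cycles es (Suc k) (v # vs) =
     (let c = v # walk es v (length vs) v (hd (neighbours es v))
      in c # cycles es k (filter (\<lambda>u. u \<notin> set c) vs))"

text \<open>A certificate: disjoint closed walks through all vertices. Pairing \<open>cs\<close>
  with \<open>rotate1 cs\<close> yields the cyclically consecutive vertices, and edges may be
  traversed in either direction.\<close>

definition odd_cycle_cover :: "'a list \<Rightarrow> ('a \<times> 'a) list \<Rightarrow> 'a list list \<Rightarrow> bool" where
  "odd_cycle_cover vs es css \<longleftrightarrow> odd (length css) \<and> distinct (concat css) \<and> set (concat css) = set vs \<and>
     (\<forall>cs\<in>set css. length cs \<ge> 3 \<and>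
        (\<forall>(x, y)\<in>set (zip cs (rotate1 cs)). (x, y) \<in> set es \<or> (y, x) \<in> set es))"

definition odd_walks :: "'a list \<Rightarrow> ('a \<times> 'a) list \<Rightarrow> bool" where
  "odd_walks vs es = odd_cycle_cover vs es (cycles es (length vs) vs)"

definition odd_complement :: "'a list \<Rightarrow> ('a \<times> 'a) list \<Rightarrow> ('a \<times> 'a) list \<Rightarrow> bool" where
  "odd_complement vs es ms = odd_walks vs (filter (\<lambda>e. e \<notin> set ms) es)"

text \<open>The predicate \<open>odd_complement\<close> is applied only partially, because \<open>code_simp\<close> would evaluate the
  body of an abstraction symbolically.\<close>

definition odd_two_factors_check :: "'a list \<Rightarrow> 'a list \<Rightarrow> ('a \<times> 'a) list \<Rightarrow> bool" where
  "odd_two_factors_check as bs es \<longleftrightarrow> distinct (as @ bs) \<and> distinct es \<and>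
     (\<forall>e\<in>set es. fst e \<in> set as \<and> snd e \<in> set bs) \<and>
     (\<forall>v\<in>set (as @ bs). length (filter (\<lambda>e. fst e = v \<or> snd e = v) es) = 3) \<and>
     list_all (odd_complement (as @ bs) es) (matchings es as [])"

lemma odd_cycle_cover_num_circuits:
  assumes cover: "odd_cycle_cover vs es css" and F: "two_factor F G" "verts F = set vs"
    and es: "\<And>x y. (x, y) \<in> set es \<Longrightarrow> {x, y} \<in> edges F"
  shows "odd (num_circuits F)"
proof -
  have "num_circuits F = length css"
  proof (rule num_circuits_eq_length)
    fix cs assume cs: "cs \<in> set css"
    then show "length cs \<ge> 3" using cover by (auto simp: odd_cycle_cover_def)
    show "edges (circuit_of cs) \<subseteq> edges F"
    proof
      fix e assume "e \<in> edges (circuit_of cs)"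
      then obtain i where i: "i < length cs" "e = {cs ! i, cs ! (Suc i mod length cs)}"
        by (auto simp: circuit_of_def)
      then have "(cs ! i, cs ! (Suc i mod length cs)) \<in> set (zip cs (rotate1 cs))"
        by (auto simp: set_zip nth_rotate1)
      then show "e \<in> edges F"
        using cs cover es i(2) unfolding odd_cycle_cover_def by (fastforce simp: insert_commute)
    qed
  qed (use cover F in \<open>auto simp: odd_cycle_cover_def two_factor_def subgraph_def\<close>)
  then show ?thesis using cover by (simp add: odd_cycle_cover_def)
qed

text \<open>The complement of a 2-factor in a cubic graph is a perfect matching, so it suffices to go
  through the perfect matchings.\<close>

lemma odd_two_factors:
  assumes check: "odd_two_factors_check as bs es" and F: "two_factor F (list_graph (as @ bs) es)"
  shows "odd (num_circuits F)"
proof -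
  let ?G = "list_graph (as @ bs) es"
  have dist: "distinct as" "set as \<inter> set bs = {}" "distinct es"
    and ends: "\<forall>e\<in>set es. fst e \<in> set as \<and> snd e \<in> set bs"
    and deg: "\<And>v. v \<in> set (as @ bs) \<Longrightarrow> length (filter (\<lambda>e. fst e = v \<or> snd e = v) es) = 3"
    using check unfolding odd_two_factors_check_def distinct_append by blast+
  have bip: "a \<in> set as" "b \<in> set bs" if "(a, b) \<in> set es" for a b
    using bspec[OF ends that] by simp_all
  have F': "verts F = set (as @ bs)" "edges F \<subseteq> edges ?G"
    and degF: "\<And>v. v \<in> set (as @ bs) \<Longrightarrow> vertex_degree F v = 2"
    using F by (auto simp: two_factor_def subgraph_def list_graph_def)
  have inj: "inj_on (\<lambda>(a, b). {a, b}) (set es)"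
  proof (rule inj_onI, clarify)
    fix a b c d assume "(a, b) \<in> set es" "(c, d) \<in> set es" "{a, b} = {c, d}"
    moreover from this have "a \<noteq> d" using bip dist(2) by blast
    ultimately show "a = c \<and> b = d" by (auto simp: doubleton_eq_iff)
  qed
  have degG: "card {e \<in> edges ?G. v \<in> e} = 3" if "v \<in> set (as @ bs)" for v
  proof -
    have "{e \<in> edges ?G. v \<in> e} = (\<lambda>(a, b). {a, b}) ` set (filter (\<lambda>e. fst e = v \<or> snd e = v) es)"
      by (auto simp: list_graph_def)
    also have "card \<dots> = card (set (filter (\<lambda>e. fst e = v \<or> snd e = v) es))"
      by (intro card_image inj_on_subset[OF inj]) auto
    also have "\<dots> = 3"
      using deg[OF that] dist(3) by (metis distinct_card distinct_filter)
    finally show ?thesis .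
  qed
  have "\<exists>e. {e \<in> edges ?G - edges F. v \<in> e} = {e}" if v: "v \<in> set (as @ bs)" for v
  proof -
    have "{e \<in> edges ?G - edges F. v \<in> e} = {e \<in> edges ?G. v \<in> e} - {e \<in> edges F. v \<in> e}"
      by auto
    moreover have "finite {e \<in> edges F. v \<in> e}"
      using degF[OF v] by (intro card_ge_0_finite) (simp add: vertex_degree_def)
    moreover have "{e \<in> edges F. v \<in> e} \<subseteq> {e \<in> edges ?G. v \<in> e}"
      using F'(2) by auto
    ultimately have "card {e \<in> edges ?G - edges F. v \<in> e} = 1"
      using degG[OF v] degF[OF v] by (simp add: card_Diff_subset vertex_degree_def)
    then show ?thesis by (rule card_1_singletonE) auto
  qed
  then obtain M where M: "\<And>v. v \<in> set (as @ bs) \<Longrightarrow> {e \<in> edges ?G - edges F. v \<in> e} = {M v}"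
    by metis
  have "\<exists>b. (a, b) \<in> set es \<and> M a = {a, b}" if a: "a \<in> set as" for a
  proof -
    have "M a \<in> edges ?G" "a \<in> M a" using M[of a] a by auto
    then obtain x y where xy: "(x, y) \<in> set es" "M a = {x, y}" "a \<in> {x, y}"
      by (auto simp: list_graph_def)
    moreover have "a \<noteq> y" using bip[OF xy(1)] a dist(2) by blast
    ultimately show ?thesis by auto
  qed
  then obtain m where m: "\<And>a. a \<in> set as \<Longrightarrow> (a, m a) \<in> set es" "\<And>a. a \<in> set as \<Longrightarrow> M a = {a, m a}"
    by metis
  \<comment> \<open>The edge missing at \<open>a\<close> is also the one missing at its other end;
    this makes \<open>m\<close> injective.\<close>
  have Mm: "M (m a) = {a, m a}" if a: "a \<in> set as" for a
  proof -
    have "{a, m a} \<in> {e \<in> edges ?G - edges F. a \<in> e}"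
      using M[of a] m(2)[OF a] a by simp
    then have "{a, m a} \<in> {e \<in> edges ?G - edges F. m a \<in> e}" by blast
    also have "\<dots> = {M (m a)}" using bip(2)[OF m(1)[OF a]] by (intro M) simp
    finally show ?thesis by simp
  qed
  have "inj_on m (set as)"
  proof (rule inj_onI)
    fix a a' assume a: "a \<in> set as" "a' \<in> set as" "m a = m a'"
    then have "{a, m a} = {a', m a}" using Mm[of a] Mm[of a'] by simp
    then show "a = a'" by (auto simp: doubleton_eq_iff)
  qed
  then have ms: "map (\<lambda>a. (a, m a)) as \<in> set (matchings es as [])"
    by (intro matchings_complete dist m) auto
  let ?es = "filter (\<lambda>e. e \<notin> set (map (\<lambda>a. (a, m a)) as)) es"
  have "odd_cycle_cover (as @ bs) ?es (cycles ?es (length (as @ bs)) (as @ bs))"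
    using check ms unfolding odd_two_factors_check_def list_all_iff odd_complement_def odd_walks_def by blast
  then show ?thesis
  proof (rule odd_cycle_cover_num_circuits[OF _ F F'(1)])
    fix x y assume "(x, y) \<in> set ?es"
    then have xy: "(x, y) \<in> set es" "(x, y) \<notin> (\<lambda>a. (a, m a)) ` set as" by simp_all
    then have x: "x \<in> set as" "y \<noteq> m x" using bip(1) by blast+
    have "{x, y} \<notin> {M x}" using x m(2)[OF x(1)] by (auto simp: doubleton_eq_iff)
    then have "{x, y} \<notin> {e \<in> edges ?G - edges F. x \<in> e}" using M[of x] x(1) by simp
    then show "{x, y} \<in> edges F" using xy(1) by (auto simp: list_graph_def)
  qed
qed

lemma graph_iso_map_graph:
  assumes inj: "inj_on f (verts G)" and sub: "\<And>e. e \<in> edges G \<Longrightarrow> e \<subseteq> verts G"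
  shows "G \<simeq>g map_graph f G"
proof -
  have "{u, v} \<in> edges G \<longleftrightarrow> {f u, f v} \<in> edges (map_graph f G)"
    if "u \<in> verts G" "v \<in> verts G" for u v
    using inj_on_image_mem_iff[OF inj_on_image_Pow[OF inj], of "{u, v}" "edges G"] that sub
    by auto
  then show ?thesis
    unfolding graph_iso_def using inj by (intro exI[of _ f]) (auto simp: bij_betw_def)
qed

text \<open>Renaming the vertices allows the check to be evaluated on integers, where numerals are compared
  in binary.\<close>

lemma odd_two_factors_pseudo:
  assumes check: "odd_two_factors_check as bs es" and inj: "inj_on f (set (as @ bs))"
  shows "pseudo_two_factor_isomorphic (list_graph (map f (as @ bs)) (map (map_prod f f) es))"
proof -
  let ?G = "list_graph (as @ bs) es"
  have "\<forall>e\<in>set es. fst e \<in> set as \<and> snd e \<in> set bs"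
    using check unfolding odd_two_factors_check_def by blast
  then have "?G \<simeq>g map_graph f ?G"
    by (intro graph_iso_map_graph) (use inj in \<open>auto simp: list_graph_def\<close>)
  moreover have "map_graph f ?G = list_graph (map f (as @ bs)) (map (map_prod f f) es)"
    by (rule graph_eqI) (auto simp: list_graph_def image_image case_prod_unfold)
  moreover have "pseudo_two_factor_isomorphic ?G"
    unfolding pseudo_two_factor_isomorphic_def using odd_two_factors[OF check] by blast
  ultimately show ?thesis
    using pseudo_two_factor_isomorphic_iso[OF graph_iso_sym] by metis
qed

text \<open>Every edge of the Pappus graph joins an odd to an even number; here it is directed from
  odd to even.\<close>

definition pappus_edges :: "(int \<times> int) list" where
  "pappus_edges = [(1, 2), (1, 18), (1, 6), (3, 2), (3, 4), (3, 14), (5, 4), (5, 6), (5, 16),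
     (7, 6), (7, 8), (7, 12), (9, 8), (9, 10), (9, 2), (11, 10), (11, 12), (11, 4),
     (13, 12), (13, 14), (13, 18), (15, 14), (15, 16), (15, 8), (17, 16), (17, 18), (17, 10)]"

lemma pappus_graph_list:
  "pappus_graph = list_graph (map nat ([1,3,5,7,9,11,13,15,17] @ [2,4,6,8,10,12,14,16,18]))
     (map (map_prod nat nat) pappus_edges)" (is "_ = ?G")
proof (rule graph_eqI)
  have interval: "{1..18 :: nat} = {1,2,3,4,5,6,7,8,9,10,11,12,13,14,15,16,17,18}"
    "{1..17 :: nat} = {1,2,3,4,5,6,7,8,9,10,11,12,13,14,15,16,17}"
    by code_simp+
  show "verts pappus_graph = verts ?G"
    unfolding pappus_graph_def list_graph_def interval by (simp, blast)
  have "{{i, i + 1} | i. i \<in> {1..17 :: nat}} = (\<lambda>i. {i, i + 1}) ` {1..17}" by blast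
  then show "edges pappus_graph = edges ?G"
    unfolding pappus_graph_def list_graph_def interval pappus_edges_def
    by (intro equalityI) (simp_all add: doubleton_eq_iff)
qed

lemma pappus_check: "odd_two_factors_check [1,3,5,7,9,11,13,15,17] [2,4,6,8,10,12,14,16,18] pappus_edges"
  by code_simp

lemma pappus_pseudo: "pseudo_two_factor_isomorphic pappus_graph"
  unfolding pappus_graph_list by (rule odd_two_factors_pseudo[OF pappus_check]) (auto simp: inj_on_def)

definition heawood_edges :: "(int \<times> int) list" where
  "heawood_edges = map (\<lambda>(j, s). (j, 7 + (j + s) mod 7)) (List.product [0..6] [0, 1, 3])"

lemma heawood_check: "odd_two_factors_check [0..6] [7..13] heawood_edges"
  by code_simp

lemma D_nat_7_list: "D_nat 7 = list_graph (map nat ([0..6] @ [7..13])) (map (map_prod nat nat) heawood_edges)"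
  (is "_ = ?G")
proof (rule graph_eqI)
  have "{..<14 :: nat} = {0,1,2,3,4,5,6,7,8,9,10,11,12,13}" by code_simp
  then show "verts (D_nat 7) = verts ?G"
    by (simp add: D_nat_def list_graph_def upto_rec1)
  have seven: "{..<7 :: nat} = {0,1,2,3,4,5,6}" by code_simp
  have "edges (D_nat 7) = (\<lambda>(j, s). {j, 7 + (j + s) mod 7}) ` ({..<7} \<times> {0, 1, 3})"
    unfolding D_nat_def by auto
  also have "\<dots> = edges ?G"
    unfolding seven by (simp add: list_graph_def heawood_edges_def upto_rec1 insert_Times_insert)
  finally show "edges (D_nat 7) = edges ?G" .
qed

lemma D_nat_7_pseudo: "pseudo_two_factor_isomorphic (D_nat 7)"
  unfolding D_nat_7_list by (rule odd_two_factors_pseudo[OF heawood_check]) (auto simp: inj_on_def)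

section \<open>Identification with the Levi graphs D(n)\<close>

text \<open>If lines \<open>i\<close> and \<open>j\<close> coincide, then i - j and j - i are both
  congruent to one of 0, 1, 3; these two residues sum to at most 6 and to 0 modulo \<open>n\<close>,
  so \<open>n \<ge> 7\<close> makes both 0.\<close>

lemma cyclic_line_inj:
  fixes n :: nat
  assumes "n \<ge> 7"
  shows "inj_on (\<lambda>i. {i, (i + 1) mod n, (i + 3) mod n}) {..<n}"
proof (rule inj_onI)
  fix i j assume i: "i \<in> {..<n}" and j: "j \<in> {..<n}"
    and eq: "{i, (i + 1) mod n, (i + 3) mod n} = {j, (j + 1) mod n, (j + 3) mod n}"
  have "i \<in> {j, (j + 1) mod n, (j + 3) mod n}" "j \<in> {i, (i + 1) mod n, (i + 3) mod n}"
    using eq by blast+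
  then show "i = j"
    using i j assms by (auto simp: mod_less_add split: if_splits)
qed

lemma D_nat_iso:
  assumes n: "n \<ge> 7" shows "D_nat n \<simeq>g D_graph n"
proof -
  define L where "L i = {i, (i + 1) mod n, (i + 3) mod n}" for i
  have injL: "i = j" if "L i = L j" "i < n" "j < n" for i j
    using cyclic_line_inj[OF n] that by (simp add: inj_on_def L_def)
  define f where "f k = (if k < n then Inr (L k) else Inl (k - n))" for k
  have V: "verts (D_graph n) = Inl ` {..<n} \<union> Inr ` L ` {..<n}"
    by (simp add: D_graph_def levi_graph_def cyclic_configuration_def L_def)
  have L_sub: "L i \<subseteq> {..<n}" if "i < n" for i
    using that n by (auto simp: L_def)
  have E: "{Inl x, Inr (L i)} \<in> edges (D_graph n) \<longleftrightarrow> x \<in> L i" if "i < n" for x i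
    using that L_sub[OF that]
    by (auto simp: D_graph_def levi_graph_def cyclic_configuration_def L_def[abs_def] doubleton_eq_iff)
  have E': "{Inl x, Inl y} \<notin> edges (D_graph n)" "{Inr X, Inr Y} \<notin> edges (D_graph n)" for x y X Y
    by (auto simp: D_graph_def levi_graph_def doubleton_eq_iff)
  have N: "{j, n + x} \<in> edges (D_nat n) \<longleftrightarrow> x \<in> L j" if "j < n" for j x
  proof
    assume "{j, n + x} \<in> edges (D_nat n)"
    then obtain i s where "{j, n + x} = {i, n + (i + s) mod n}" "i < n" "s \<in> {0, 1, 3}"
      unfolding D_nat_def by simp blast
    then show "x \<in> L j" using that by (auto simp: L_def doubleton_eq_iff)
  next
    assume "x \<in> L j"
    then have "x \<in> (\<lambda>s. (j + s) mod n) ` {0, 1, 3}" using that by (simp add: L_def)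
    then show "{j, n + x} \<in> edges (D_nat n)"
      using that unfolding D_nat_def by (simp only: graph.select_convs) blast
  qed
  have N': "{i, j} \<notin> edges (D_nat n)" "{n + i, n + j} \<notin> edges (D_nat n)" if "i < n" "j < n" for i j
    using that by (auto simp: D_nat_def doubleton_eq_iff)
  have "bij_betw f (verts (D_nat n)) (verts (D_graph n))"
  proof (rule bij_betw_imageI)
    show "inj_on f (verts (D_nat n))"
      using injL by (auto simp: inj_on_def f_def D_nat_def split: if_splits)
    have "verts (D_nat n) = {..<n} \<union> (+) n ` {..<n}"
      using bij_betw_add_lessThan[of n] by (auto simp: bij_betw_def D_nat_def)
    then show "f ` verts (D_nat n) = verts (D_graph n)"
    proof -
      have "f ` {..<n} = Inr ` L ` {..<n}" "f ` (+) n ` {..<n} = Inl ` {..<n}"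
        unfolding image_image by (rule image_cong; simp add: f_def)+
      then show ?thesis by (simp add: \<open>verts (D_nat n) = _\<close> V image_Un Un_commute)
    qed
  qed
  moreover have "{u, v} \<in> edges (D_nat n) \<longleftrightarrow> {f u, f v} \<in> edges (D_graph n)"
    if "u \<in> verts (D_nat n)" "v \<in> verts (D_nat n)" for u v
  proof -
    have "u < 2 * n" "v < 2 * n" using that by (auto simp: D_nat_def)
    then consider "u < n" "v < n" | x where "u < n" "v = n + x" | x where "v < n" "u = n + x"
      | x y where "u = n + x" "v = n + y" "x < n" "y < n"
      by (metis add_less_cancel_left le_iff_add mult_2 not_less)
    then show ?thesis
    proof cases
      case 1
      then show ?thesis using N'(1) E'(2) by (simp add: f_def)
    next
      case 2
      then show ?thesis using N E by (simp add: f_def insert_commute)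
    next
      case 3
      then show ?thesis using N E by (simp add: f_def insert_commute)
    next
      case 4
      then show ?thesis using N'(2) E'(1) by (simp add: f_def)
    qed
  qed
  ultimately show ?thesis unfolding graph_iso_def by blast
qed

lemma D_graph_7: "D_graph 7 = heawood_graph"
proof -
  have "{..<7 :: nat} = {0, 1, 2, 3, 4, 5, 6}" by auto
  then have "cyclic_configuration 7 = fano_plane"
    by (simp add: cyclic_configuration_def fano_plane_def insert_commute flip: One_nat_def)
  then show ?thesis by (simp add: D_graph_def heawood_graph_def)
qed

theorem theorem3p1:
  fixes G :: "'a graph"
  assumes boben_classification:
    "\<And>H :: 'a graph. simple_graph H \<Longrightarrow>
       irreducible_levi_graph H \<longleftrightarrow>
         (\<exists>n\<ge>7. H \<simeq>g D_graph n) \<or>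
         (\<exists>n\<ge>1. H \<simeq>g T1_graph n \<or> H \<simeq>g T2_graph n \<or> H \<simeq>g T3_graph n) \<or>
         H \<simeq>g pappus_graph"
    and "simple_graph G"
  shows "irreducible_levi_graph G \<and> pseudo_two_factor_isomorphic G \<longleftrightarrow>
           G \<simeq>g heawood_graph \<or> G \<simeq>g pappus_graph"
proof
  assume G: "irreducible_levi_graph G \<and> pseudo_two_factor_isomorphic G"
  have transfer: "pseudo_two_factor_isomorphic H" if "G \<simeq>g H" for H :: "'b graph"
    using pseudo_two_factor_isomorphic_iso[OF graph_iso_sym[OF that]] G by blast
  have D: "n = 7" if "n \<ge> 7" "G \<simeq>g D_graph n" for n
  proof (rule ccontr)
    assume "n \<noteq> 7"
    then have "\<not> pseudo_two_factor_isomorphic (D_nat n)"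
      using that(1) by (intro D_nat_not_pseudo_ge_8) simp
    moreover have "pseudo_two_factor_isomorphic (D_graph n)"
      using pseudo_two_factor_isomorphic_iso[OF graph_iso_sym[OF that(2)]] G by blast
    ultimately show False
      using pseudo_two_factor_isomorphic_iso[OF D_nat_iso[OF that(1)]] by blast
  qed
  have T: "\<not> (G \<simeq>g T1_graph n \<or> G \<simeq>g T2_graph n \<or> G \<simeq>g T3_graph n)" if "n \<ge> 1" for n
    using T_graphs_not_pseudo[OF that] transfer by blast
  show "G \<simeq>g heawood_graph \<or> G \<simeq>g pappus_graph"
    using G boben_classification[OF assms(2)] D T D_graph_7 by metis
next
  assume G: "G \<simeq>g heawood_graph \<or> G \<simeq>g pappus_graph"
  have "pseudo_two_factor_isomorphic heawood_graph"
    using pseudo_two_factor_isomorphic_iso[OF graph_iso_sym[OF D_nat_iso[of 7]] D_nat_7_pseudo]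
    by (simp add: D_graph_7)
  then have "pseudo_two_factor_isomorphic G"
    using G pappus_pseudo by (auto intro: pseudo_two_factor_isomorphic_iso)
  \<comment> \<open>Irreducibility and connectedness are read off the classification, the Heawood
    graph entering as its member D(7).\<close>
  moreover have "irreducible_levi_graph G"
    using G boben_classification[OF assms(2)] D_graph_7 by (metis order_refl)
  ultimately show "irreducible_levi_graph G \<and> pseudo_two_factor_isomorphic G" by blast
qed

end
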